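(* Let $(W,S)$ be a Coxeter system, let $I_\bullet=[I_0,\dots,I_n]$ be a singular expression, and let $p$ be its endpoint (the double coset it expresses). Then $\ell^+(I_\bullet)\ge\ell^+(p)$ and $\ell^-(I_\bullet)\ge\ell^-(p)$. Moreover, the following are equivalent: (1) $I_\bullet$ is reduced; (2) $\ell^+(I_\bullet)=\ell^+(p)$ and $\ell^-(I_\bullet)=\ell^-(p)$; (3) $\ell(I_\bullet)=\ell(p)$.
   Context: Let $(W,S)$ be a Coxeter system with identity $e$, length function $\ell_W$ and Bruhat order $\le$. For $I\subset S$ let $W_I$ be the parabolic subgroup generated by $I$; $I$ is finitary if $W_I$ is finite, and then $w_I$ is the longest element of $W_I$ and $\ell(I):=\ell_W(w_I)$. For finitary $I,J$, a $(J,I)$-coset is a double coset $p\in W_J\backslash W/W_I$ (the pair $(J,I)$ is part of the data); it has a unique Bruhat-maximal element $\overline{p}$ and a unique Bruhat-minimal element $\underline{p}$. A singular expression is a sequence $[I_0,\dots,I_n]$ of finitary subsets of $S$, consecutive ones differing by adding or removing exactly one element of $S$. Its forward path is the sequence $p_0,\dots,p_n$ where $p_i$ is an $(I_0,I_i)$-coset, $e\in p_0$; if $I_i\subset I_{i+1}$, $p_{i+1}$ is the $(I_0,I_{i+1})$-coset containing $p_i$; if $I_i\supset I_{i+1}$, $p_{i+1}$ is the $(I_0,I_{i+1})$-coset containing $\overline{p_i}$. The endpoint is $p_n$. Put $K_i=I_0\cap\underline{p_i}I_i\underline{p_i}^{-1}$. The expression is reduced if for every $i$ with $I_i\subset I_{i+1}$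 one has $\underline{p_i}=\underline{p_{i+1}}$ and $K_i=K_{i+1}$. Lengths: for a $(J,I)$-coset $p$, $\ell^+(p)=\ell_W(\overline p)-\ell(J)$, $\ell^-(p)=\ell_W(\underline p)+\ell(J)-\ell(J\cap\underline pI\underline p^{-1})$, and $\ell(p)=\ell^+(p)+\ell^-(p)$. For an expression, $d_0^\pm=0$ and for $i\ge1$: if $I_{i-1}\subset I_i$ then $d_i^+=\ell(I_i)-\ell(I_{i-1})$, $d_i^-=0$; if $I_{i-1}\supset I_i$ then $d_i^+=0$, $d_i^-=\ell(I_{i-1})-\ell(I_i)$. Then $\ell^\pm(I_\bullet)=\sum_{i=0}^nd_i^\pm$ and $\ell(I_\bullet)=\ell^+(I_\bullet)+\ell^-(I_\bullet)$. *)

theory Defs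
  imports
    "HOL-Algebra.Coset"
    "HOL-Algebra.Generated_Groups"
    "HOL-Algebra.Multiplicative_Group"
begin

section \<open>Coxeter systems\<close>

definition word_prod :: "('a, 'b) monoid_scheme \<Rightarrow> 'a list \<Rightarrow> 'a" where
  "word_prod W xs = foldr (\<lambda>x y. x \<otimes>\<^bsub>W\<^esub> y) xs \<one>\<^bsub>W\<^esub>"

text \<open>The congruence on words over \<open>S\<close> generated by the relations
  \<open>(s t)\<^sup>m = 1\<close>, where \<open>m\<close> is the order of \<open>s t\<close> in \<open>W\<close>. For \<open>s = t\<close>
  this is the relation \<open>s s = 1\<close>, so each generator is its own formal inverse and the quotient
  of the free monoid by this congruence is the group with generators \<open>S\<close> and these relations.
  Elements of infinite order have \<open>group.ord\<close> equal to \<open>0\<close> and contribute only the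
  empty relation.\<close>

inductive coxeter_congruent :: "('a, 'b) monoid_scheme \<Rightarrow> 'a set \<Rightarrow> 'a list \<Rightarrow> 'a list \<Rightarrow> bool"
  for W :: "('a, 'b) monoid_scheme" and S :: "'a set" where
  relation: "\<lbrakk>s \<in> S; t \<in> S; set u \<subseteq> S; set v \<subseteq> S\<rbrakk> \<Longrightarrow>
    coxeter_congruent W S
      (u @ concat (replicate (group.ord W (s \<otimes>\<^bsub>W\<^esub> t)) [s, t]) @ v) (u @ v)"
| refl: "set u \<subseteq> S \<Longrightarrow> coxeter_congruent W S u u"
| sym: "coxeter_congruent W S u v \<Longrightarrow> coxeter_congruent W S v u"
| trans: "\<lbrakk>coxeter_congruent W S u v; coxeter_congruent W S v w\<rbrakk> \<Longrightarrow> coxeter_congruent W S u w"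

text \<open>The set \<open>S\<close> may be infinite. The converse of \<open>presentation\<close> holds in every group.\<close>

locale coxeter_system = group W for W :: "('a, 'b) monoid_scheme" (structure) +
  fixes S :: "'a set"
  assumes gens_closed: "S \<subseteq> carrier W"
    and gens_generate: "generate W S = carrier W"
    and gens_order: "s \<in> S \<Longrightarrow> ord s = 2"
    and presentation:
      "\<lbrakk>set u \<subseteq> S; set v \<subseteq> S; word_prod W u = word_prod W v\<rbrakk> \<Longrightarrow> coxeter_congruent W S u v"

definition cox_length :: "('a, 'b) monoid_scheme \<Rightarrow> 'a set \<Rightarrow> 'a \<Rightarrow> nat" where
  "cox_length W S w = (LEAST n. \<exists>xs. set xs \<subseteq> S \<and> length xs = n \<and> word_prod W xs = w)"

definition reflections :: "('a, 'b) monoid_scheme \<Rightarrow> 'a set \<Rightarrow> 'a set" where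
  "reflections W S = {w \<otimes>\<^bsub>W\<^esub> s \<otimes>\<^bsub>W\<^esub> inv\<^bsub>W\<^esub> w | w s. w \<in> carrier W \<and> s \<in> S}"

definition bruhat_step :: "('a, 'b) monoid_scheme \<Rightarrow> 'a set \<Rightarrow> ('a \<times> 'a) set" where
  "bruhat_step W S = {(x, y). x \<in> carrier W \<and> (\<exists>t \<in> reflections W S. y = x \<otimes>\<^bsub>W\<^esub> t)
     \<and> cox_length W S x < cox_length W S y}"

definition bruhat_le :: "('a, 'b) monoid_scheme \<Rightarrow> 'a set \<Rightarrow> 'a \<Rightarrow> 'a \<Rightarrow> bool" where
  "bruhat_le W S x y \<longleftrightarrow> (x, y) \<in> (bruhat_step W S)\<^sup>*"


section \<open>Parabolic subgroups and double cosets\<close>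

text \<open>The parabolic subgroup \<open>W\<^sub>I\<close> is \<open>generate W I\<close>.\<close>

definition finitary :: "('a, 'b) monoid_scheme \<Rightarrow> 'a set \<Rightarrow> 'a set \<Rightarrow> bool" where
  "finitary W S I \<longleftrightarrow> I \<subseteq> S \<and> finite (generate W I)"

definition longest_elt :: "('a, 'b) monoid_scheme \<Rightarrow> 'a set \<Rightarrow> 'a set \<Rightarrow> 'a" where
  "longest_elt W S I =
    (THE w. w \<in> generate W I \<and> (\<forall>v \<in> generate W I. cox_length W S v \<le> cox_length W S w))"

text \<open>Lengths are integers, so that the subtractions below are not truncated.\<close>

definition len :: "('a, 'b) monoid_scheme \<Rightarrow> 'a set \<Rightarrow> 'a \<Rightarrow> int" where
  "len W S w = int (cox_length W S w)"

definition plen :: "('a, 'b) monoid_scheme \<Rightarrow> 'a set \<Rightarrow> 'a set \<Rightarrow> int" where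
  "plen W S I = len W S (longest_elt W S I)"

text \<open>\<open>double_cosets W J I\<close> is the set of \<open>(J, I)\<close>-cosets. A \<open>(J, I)\<close>-coset is
  represented by its underlying set; the pair \<open>(J, I)\<close>, which the set does not determine, is an
  argument of the functions depending on it.\<close>

definition double_cosets :: "('a, 'b) monoid_scheme \<Rightarrow> 'a set \<Rightarrow> 'a set \<Rightarrow> 'a set set" where
  "double_cosets W J I =
    {generate W J <#>\<^bsub>W\<^esub> {w} <#>\<^bsub>W\<^esub> generate W I | w. w \<in> carrier W}"

definition coset_containing ::
    "('a, 'b) monoid_scheme \<Rightarrow> 'a set \<Rightarrow> 'a set \<Rightarrow> 'a set \<Rightarrow> 'a set" where
  "coset_containing W J I X = (THE q. q \<in> double_cosets W J I \<and> X \<subseteq> q)"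

definition max_elt :: "('a, 'b) monoid_scheme \<Rightarrow> 'a set \<Rightarrow> 'a set \<Rightarrow> 'a" where
  "max_elt W S p = (THE x. x \<in> p \<and> (\<forall>y \<in> p. bruhat_le W S x y \<longrightarrow> y = x))"

definition min_elt :: "('a, 'b) monoid_scheme \<Rightarrow> 'a set \<Rightarrow> 'a set \<Rightarrow> 'a" where
  "min_elt W S p = (THE x. x \<in> p \<and> (\<forall>y \<in> p. bruhat_le W S y x \<longrightarrow> y = x))"

text \<open>The set \<open>J \<inter> p\<^sub>m I p\<^sub>m\<^sup>-\<^sup>1\<close>, where \<open>p\<^sub>m\<close> is the minimal element of the
  \<open>(J, I)\<close>-coset \<open>p\<close>.\<close>

definition left_redundancy ::
    "('a, 'b) monoid_scheme \<Rightarrow> 'a set \<Rightarrow> 'a set \<Rightarrow> 'a set \<Rightarrow> 'a set \<Rightarrow> 'a set" where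
  "left_redundancy W S J I p =
    J \<inter> {min_elt W S p \<otimes>\<^bsub>W\<^esub> s \<otimes>\<^bsub>W\<^esub> inv\<^bsub>W\<^esub> (min_elt W S p) | s. s \<in> I}"

definition coset_len_plus ::
    "('a, 'b) monoid_scheme \<Rightarrow> 'a set \<Rightarrow> 'a set \<Rightarrow> 'a set \<Rightarrow> 'a set \<Rightarrow> int" where
  "coset_len_plus W S J I p = len W S (max_elt W S p) - plen W S J"

definition coset_len_minus ::
    "('a, 'b) monoid_scheme \<Rightarrow> 'a set \<Rightarrow> 'a set \<Rightarrow> 'a set \<Rightarrow> 'a set \<Rightarrow> int" where
  "coset_len_minus W S J I p =
    len W S (min_elt W S p) + plen W S J - plen W S (left_redundancy W S J I p)"

definition coset_len ::
    "('a, 'b) monoid_scheme \<Rightarrow> 'a set \<Rightarrow> 'a set \<Rightarrow> 'a set \<Rightarrow> 'a set \<Rightarrow> int" where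
  "coset_len W S J I p = coset_len_plus W S J I p + coset_len_minus W S J I p"


section \<open>Singular expressions\<close>

text \<open>The expression \<open>[I\<^sub>0, \<dots>, I\<^sub>n]\<close> is a list of length \<open>n + 1\<close>.\<close>

definition singular_expression :: "('a, 'b) monoid_scheme \<Rightarrow> 'a set \<Rightarrow> 'a set list \<Rightarrow> bool" where
  "singular_expression W S Is \<longleftrightarrow>
    Is \<noteq> [] \<and> (\<forall>I \<in> set Is. finitary W S I) \<and>
    (\<forall>i. Suc i < length Is \<longrightarrow>
      (\<exists>s \<in> S. (s \<notin> Is ! i \<and> Is ! Suc i = insert s (Is ! i)) \<or>
               (s \<in> Is ! i \<and> Is ! Suc i = Is ! i - {s})))"

primrec forward_path ::
    "('a, 'b) monoid_scheme \<Rightarrow> 'a set \<Rightarrow> 'a set list \<Rightarrow> nat \<Rightarrow> 'a set" where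
  "forward_path W S Is 0 = coset_containing W (Is ! 0) (Is ! 0) {\<one>\<^bsub>W\<^esub>}"
| "forward_path W S Is (Suc i) =
    (if Is ! i \<subset> Is ! Suc i
     then coset_containing W (Is ! 0) (Is ! Suc i) (forward_path W S Is i)
     else coset_containing W (Is ! 0) (Is ! Suc i) {max_elt W S (forward_path W S Is i)})"

definition endpoint :: "('a, 'b) monoid_scheme \<Rightarrow> 'a set \<Rightarrow> 'a set list \<Rightarrow> 'a set" where
  "endpoint W S Is = forward_path W S Is (length Is - 1)"

definition reduced_expression :: "('a, 'b) monoid_scheme \<Rightarrow> 'a set \<Rightarrow> 'a set list \<Rightarrow> bool" where
  "reduced_expression W S Is \<longleftrightarrow>
    (\<forall>i. Suc i < length Is \<and> Is ! i \<subset> Is ! Suc i \<longrightarrow>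
      min_elt W S (forward_path W S Is i) = min_elt W S (forward_path W S Is (Suc i)) \<and>
      left_redundancy W S (Is ! 0) (Is ! i) (forward_path W S Is i) =
      left_redundancy W S (Is ! 0) (Is ! Suc i) (forward_path W S Is (Suc i)))"

definition d_plus :: "('a, 'b) monoid_scheme \<Rightarrow> 'a set \<Rightarrow> 'a set list \<Rightarrow> nat \<Rightarrow> int" where
  "d_plus W S Is i =
    (if i \<ge> 1 \<and> Is ! (i - 1) \<subset> Is ! i then plen W S (Is ! i) - plen W S (Is ! (i - 1)) else 0)"

definition d_minus :: "('a, 'b) monoid_scheme \<Rightarrow> 'a set \<Rightarrow> 'a set list \<Rightarrow> nat \<Rightarrow> int" where
  "d_minus W S Is i =
    (if i \<ge> 1 \<and> Is ! i \<subset> Is ! (i - 1) then plen W S (Is ! (i - 1)) - plen W S (Is ! i) else 0)"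

definition expr_len_plus :: "('a, 'b) monoid_scheme \<Rightarrow> 'a set \<Rightarrow> 'a set list \<Rightarrow> int" where
  "expr_len_plus W S Is = (\<Sum>i = 0..length Is - 1. d_plus W S Is i)"

definition expr_len_minus :: "('a, 'b) monoid_scheme \<Rightarrow> 'a set \<Rightarrow> 'a set list \<Rightarrow> int" where
  "expr_len_minus W S Is = (\<Sum>i = 0..length Is - 1. d_minus W S Is i)"

definition expr_len :: "('a, 'b) monoid_scheme \<Rightarrow> 'a set \<Rightarrow> 'a set list \<Rightarrow> int" where
  "expr_len W S Is = expr_len_plus W S Is + expr_len_minus W S Is"

end

theory Submission
  imports Defs
begin

text \<open>Fix \<open>J = I\<^sub>0\<close>, and for a \<open>(J, I)\<close>-coset \<open>p\<close> with minimal element \<open>x\<close> put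
  \<open>K = J \<inter> x I x\<^sup>-\<^sup>1\<close>. The main input from Coxeter group theory is that every element of \<open>p\<close> is a
  product \<open>u x v\<close> with \<open>u \<in> W\<^sub>J\<close> minimal modulo \<open>W\<^sub>K\<close> and \<open>v \<in> W\<^sub>I\<close>, and that the lengths of the three
  factors add up (\<open>dcoset_factor\<close>, \<open>triple_add\<close>). The maximal element is therefore
  \<open>w\<^sub>J w\<^sub>K\<^sup>-\<^sup>1 x w\<^sub>I\<close>, so that
  \<open>\<ell>\<^sup>+(p) = \<ell>(x) + \<ell>(I) - \<ell>(K)\<close> and \<open>\<ell>\<^sup>-(p) = \<ell>(x) + \<ell>(J) - \<ell>(K)\<close>.
  In particular \<open>\<ell>\<^sup>+(p) - \<ell>\<^sup>-(p) = \<ell>(I) - \<ell>(J)\<close> (\<open>coset_len_plus_minus\<close>). An expression from \<open>J\<close> to \<open>I\<close>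
  has the same difference, by telescoping (\<open>path_plus_minus\<close>). So the two
  inequalities are equivalent, the conditions (2) and (3) are both equivalent to equality of the
  negative lengths, and only \<open>\<ell>\<^sup>-\<close> has to be followed along the forward path.

  When \<open>I\<close> shrinks to \<open>I'\<close>, the maximal element of the coset does not change, so \<open>\<ell>\<^sup>+\<close> does not change
  and \<open>\<ell>\<^sup>-\<close> grows by exactly \<open>\<ell>(I) - \<ell>(I')\<close>, which is the contribution of this step to the
  expression (\<open>shrink_step\<close>). When \<open>I\<close> grows to \<open>I'\<close>, the expression gains nothing, and \<open>\<ell>\<^sup>-\<close> cannot
  increase: write the maximal element as \<open>a w\<^sub>I\<close>, with \<open>\<ell>\<^sup>-(p) = \<ell>(a)\<close>; the new maximal element is
  \<open>b w\<^sub>I\<^sub>'\<close> with \<open>b\<close> the shortest element of \<open>a W\<^sub>I\<^sub>'\<close>, and the new value is \<open>\<ell>(b)\<close>. If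
  \<open>\<ell>(b) = \<ell>(a)\<close>, then \<open>a = b\<close>; as \<open>a\<close> ends in \<open>x\<close>, the element \<open>x\<close> is still minimal in the new coset, and
  \<open>K\<close>, which can only have grown, has a longest element of the same length and is
  unchanged (\<open>enlarge_step\<close>). Hence the defect \<open>\<ell>\<^sup>-(I\<^sub>\<bullet>) - \<ell>\<^sup>-(p)\<close> is nonnegative and vanishes
  exactly if no enlarging step violates the condition of reducedness (\<open>path_minus\<close>).

  The Coxeter group theory is developed from the presentation. All of it rests on the inversions of
  an element: the parity with which a reflection occurs among the
  \<open>s\<^sub>1 \<dots> s\<^sub>i\<^sub>-\<^sub>1 s\<^sub>i s\<^sub>i\<^sub>-\<^sub>1 \<dots> s\<^sub>1\<close> is an invariant of the element \<open>s\<^sub>1 \<dots> s\<^sub>n\<close>. This gives the strong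
  exchange property and, from the cocycle rule \<open>inversion_mult\<close>, the following
  consequence \<open>descent_split\<close>, which drives the induction arguments on lengths: a descent \<open>s\<close> of
  \<open>x y\<close> is a descent of \<open>y\<close>, or the reflection \<open>y s y\<^sup>-\<^sup>1\<close> shortens \<open>x\<close>.\<close>

section \<open>Words and parabolic subgroups\<close>

context coxeter_system
begin

abbreviation ell :: "'a \<Rightarrow> nat" where "ell \<equiv> cox_length W S"

abbreviation par :: "'a set \<Rightarrow> 'a set" where "par \<equiv> generate W"

lemma inv_cancel_left:
  "x \<in> carrier W \<Longrightarrow> y \<in> carrier W \<Longrightarrow> x \<otimes> (inv x \<otimes> y) = y"
  "x \<in> carrier W \<Longrightarrow> y \<in> carrier W \<Longrightarrow> inv x \<otimes> (x \<otimes> y) = y"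
  by (simp_all flip: m_assoc)

lemma gen_closed [simp, intro]: "s \<in> S \<Longrightarrow> s \<in> carrier W"
  using gens_closed by blast

lemma gen_square: assumes "s \<in> S" shows "s \<otimes> s = \<one>"
proof -
  have "s [^] (2::nat) = \<one>"
    using pow_ord_eq_1[of s] gens_order[OF assms] gen_closed[OF assms] by simp
  then show ?thesis using gen_closed[OF assms] by (simp add: numeral_2_eq_2)
qed

lemma gen_inv: "s \<in> S \<Longrightarrow> inv s = s"
  using gen_square inv_equality by blast

lemma gen_neq_one: "s \<in> S \<Longrightarrow> s \<noteq> \<one>"
  using gens_order[of s] ord_eq_1[OF one_closed] by auto

lemma gen_cancel_left: "s \<in> S \<Longrightarrow> y \<in> carrier W \<Longrightarrow> s \<otimes> (s \<otimes> y) = y"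
  using gen_inv inv_cancel_left(1)[of s y] by auto

lemma gen_cancel_right: "s \<in> S \<Longrightarrow> y \<in> carrier W \<Longrightarrow> y \<otimes> s \<otimes> s = y"
  by (simp add: m_assoc gen_square)

lemma word_prod_Nil [simp]: "word_prod W [] = \<one>"
  by (simp add: word_prod_def)

lemma word_prod_Cons [simp]: "word_prod W (s # xs) = s \<otimes> word_prod W xs"
  by (simp add: word_prod_def)

lemma word_prod_closed [simp, intro]: "set xs \<subseteq> S \<Longrightarrow> word_prod W xs \<in> carrier W"
  by (induction xs) auto

lemma word_prod_append:
  "set xs \<subseteq> S \<Longrightarrow> set ys \<subseteq> S \<Longrightarrow> word_prod W (xs @ ys) = word_prod W xs \<otimes> word_prod W ys"
  by (induction xs) (auto simp: m_assoc)

lemma word_prod_rev: "set xs \<subseteq> S \<Longrightarrow> word_prod W (rev xs) = inv (word_prod W xs)"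
  by (induction xs) (auto simp: word_prod_append inv_mult_group gen_inv)

lemma parabolic_closed: "I \<subseteq> S \<Longrightarrow> v \<in> par I \<Longrightarrow> v \<in> carrier W"
  using generate_in_carrier[of I v] gens_closed by auto

lemma parabolic_subgroup: "I \<subseteq> S \<Longrightarrow> subgroup (par I) W"
  by (rule generate_is_subgroup) (use gens_closed in blast)

lemma parabolic_mult: "v \<in> par I \<Longrightarrow> w \<in> par I \<Longrightarrow> v \<otimes> w \<in> par I"
  by (rule generate.eng)

lemma parabolic_one: "\<one> \<in> par I"
  by (rule generate.one)

lemma parabolic_gen: "s \<in> I \<Longrightarrow> s \<in> par I"
  by (rule generate.incl)

lemma parabolic_inv: "I \<subseteq> S \<Longrightarrow> v \<in> par I \<Longrightarrow> inv v \<in> par I"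
  by (rule subgroup.m_inv_closed[OF parabolic_subgroup])

lemma parabolic_word:
  assumes "I \<subseteq> S" "v \<in> par I"
  shows "\<exists>xs. set xs \<subseteq> I \<and> word_prod W xs = v"
  using assms(2)
proof induction
    case one
    show ?case by (intro exI[of _ "[]"]) simp
  next
    case (incl s)
    then show ?case using assms(1) by (intro exI[of _ "[s]"]) auto
  next
    case (inv s)
    then show ?case using assms(1) by (intro exI[of _ "[s]"]) (auto simp: gen_inv)
  next
    case (eng v w)
    then obtain xs ys where "set xs \<subseteq> I" "word_prod W xs = v" "set ys \<subseteq> I" "word_prod W ys = w"
      by blast
    then show ?case using assms(1)
      by (intro exI[of _ "xs @ ys"]) (simp add: word_prod_append)
qed

lemma word_in_parabolic: "set xs \<subseteq> I \<Longrightarrow> word_prod W xs \<in> par I"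
  by (induction xs) (simp_all add: parabolic_one parabolic_mult parabolic_gen)

lemma ex_word: "w \<in> carrier W \<Longrightarrow> \<exists>xs. set xs \<subseteq> S \<and> word_prod W xs = w"
  using parabolic_word[of S w] gens_generate by simp

section \<open>Length\<close>

lemma ell_le: "set xs \<subseteq> S \<Longrightarrow> ell (word_prod W xs) \<le> length xs"
  unfolding cox_length_def by (rule Least_le, rule exI[of _ xs]) simp

lemma ex_reduced_word:
  assumes "w \<in> carrier W"
  shows "\<exists>xs. set xs \<subseteq> S \<and> word_prod W xs = w \<and> length xs = ell w"
proof -
  have "\<exists>n xs. set xs \<subseteq> S \<and> length xs = n \<and> word_prod W xs = w"
    using ex_word[OF assms] by blast
  from LeastI_ex[OF this] show ?thesis
    unfolding cox_length_def by blast
qed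

lemma ell_one [simp]: "ell \<one> = 0"
  using ell_le[of "[]"] by simp

lemma ell_eq_0: "w \<in> carrier W \<Longrightarrow> ell w = 0 \<Longrightarrow> w = \<one>"
  by (metis ex_reduced_word length_0_conv word_prod_Nil)

lemma ell_gen: "s \<in> S \<Longrightarrow> ell s = 1"
  using ell_le[of "[s]"] ell_eq_0[of s] gen_neq_one[of s] by fastforce

lemma ell_mult:
  assumes "x \<in> carrier W" "y \<in> carrier W"
  shows "ell (x \<otimes> y) \<le> ell x + ell y"
proof -
  obtain xs where "set xs \<subseteq> S" "word_prod W xs = x" "length xs = ell x"
    using ex_reduced_word[OF assms(1)] by blast
  moreover obtain ys where "set ys \<subseteq> S" "word_prod W ys = y" "length ys = ell y"
    using ex_reduced_word[OF assms(2)] by blast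
  ultimately show ?thesis
    using ell_le[of "xs @ ys"] by (auto simp: word_prod_append)
qed

lemma ell_inv: assumes "x \<in> carrier W" shows "ell (inv x) = ell x"
proof -
  have le: "ell (inv y) \<le> ell y" if y: "y \<in> carrier W" for y
  proof -
    obtain ys where "set ys \<subseteq> S" "word_prod W ys = y" "length ys = ell y"
      using ex_reduced_word[OF y] by blast
    then show ?thesis using ell_le[of "rev ys"] by (auto simp: word_prod_rev)
  qed
  show ?thesis using le[of x] le[of "inv x"] assms by simp
qed

section \<open>Inversions and the strong exchange property\<close>

text \<open>For \<open>s\<^sub>1 \<dots> s\<^sub>n\<close> this lists the reflections \<open>s\<^sub>1 \<dots> s\<^sub>i\<^sub>-\<^sub>1 s\<^sub>i s\<^sub>i\<^sub>-\<^sub>1 \<dots> s\<^sub>1\<close>. Multiplying the word from the left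
  by the \<open>i\<close>-th of them deletes the letter \<open>s\<^sub>i\<close>.\<close>

primrec inversion_seq :: "'a list \<Rightarrow> 'a list" where
  "inversion_seq [] = []"
| "inversion_seq (s # xs) = s # map (\<lambda>t. s \<otimes> t \<otimes> inv s) (inversion_seq xs)"

lemma inversion_seq_closed: "set xs \<subseteq> S \<Longrightarrow> set (inversion_seq xs) \<subseteq> carrier W"
  by (induction xs) auto

lemma inversion_seq_append:
  assumes "set xs \<subseteq> S" "set ys \<subseteq> S"
  shows "inversion_seq (xs @ ys) = inversion_seq xs @
    map (\<lambda>t. word_prod W xs \<otimes> t \<otimes> inv (word_prod W xs)) (inversion_seq ys)"
  using assms(1)
proof (induction xs)
  case Nil
  have "map (\<lambda>t. \<one> \<otimes> t \<otimes> inv \<one>) (inversion_seq ys) = map (\<lambda>t. t) (inversion_seq ys)"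
    by (rule map_cong) (use inversion_seq_closed[OF assms(2)] in auto)
  then show ?case by simp
next
  case (Cons s xs)
  then show ?case using inversion_seq_closed[OF assms(2)]
    by (auto simp: inv_mult_group m_assoc)
qed

lemma count_list_conjugate:
  assumes "x \<in> carrier W" "t \<in> carrier W" "set ts \<subseteq> carrier W"
  shows "count_list (map (\<lambda>t. x \<otimes> t \<otimes> inv x) ts) t = count_list ts (inv x \<otimes> t \<otimes> x)"
  using assms(3)
proof (induction ts)
  case (Cons r ts)
  have "x \<otimes> r \<otimes> inv x = t \<longleftrightarrow> r = inv x \<otimes> t \<otimes> x"
    using assms Cons.prems by (auto simp: m_assoc inv_cancel_left)
  then show ?case using Cons by auto
qed simp

lemma count_inversion_seq_append:
  assumes "set xs \<subseteq> S" "set ys \<subseteq> S" "t \<in> carrier W"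
  shows "count_list (inversion_seq (xs @ ys)) t = count_list (inversion_seq xs) t +
    count_list (inversion_seq ys) (inv (word_prod W xs) \<otimes> t \<otimes> word_prod W xs)"
  using assms by (simp add: inversion_seq_append count_list_conjugate inversion_seq_closed)

text \<open>In the dihedral group generated by \<open>s\<close> and \<open>t\<close>, conjugation by \<open>s\<close> inverts \<open>s t\<close>. This puts the
  reflections in the inversion sequence of an alternating word into the uniform shape \<open>(s t)\<^sup>i s\<close>.\<close>

lemma dihedral_swap:
  assumes "s \<in> S" "t \<in> S"
  shows "s \<otimes> inv ((s \<otimes> t) [^] (k::nat)) = (s \<otimes> t) [^] k \<otimes> s"
proof (induction k)
  case (Suc k)
  have c: "(s \<otimes> t) [^] k \<in> carrier W" using assms by auto
  have "s \<otimes> inv ((s \<otimes> t) [^] Suc k) = s \<otimes> inv (s \<otimes> t) \<otimes> inv ((s \<otimes> t) [^] k)"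
    using assms c by (simp add: inv_mult_group m_assoc)
  also have "\<dots> = s \<otimes> t \<otimes> (s \<otimes> inv ((s \<otimes> t) [^] k))"
    using assms c by (simp add: inv_mult_group m_assoc gen_inv)
  also have "\<dots> = s \<otimes> t \<otimes> (s \<otimes> t) [^] k \<otimes> s"
    using assms c Suc by (simp add: m_assoc)
  also have "\<dots> = (s \<otimes> t) [^] Suc k \<otimes> s"
    using assms by (metis gen_closed m_closed nat_pow_Suc nat_pow_Suc2)
  finally show ?case .
qed (use assms in simp)

lemma alternating_word_subset:
  "s \<in> S \<Longrightarrow> t \<in> S \<Longrightarrow> set (concat (replicate k [s, t])) \<subseteq> S"
  by (induction k) auto

lemma alternating_word_prod:
  assumes "s \<in> S" "t \<in> S"
  shows "word_prod W (concat (replicate k [s, t])) = (s \<otimes> t) [^] k"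
proof (induction k)
  case (Suc k)
  then show ?case using assms
    by (metis append_Cons append_Nil concat.simps(2) gen_closed m_assoc m_closed nat_pow_Suc2
        nat_pow_closed replicate_Suc word_prod_Cons)
qed simp

lemma alternating_inversion_seq:
  assumes "s \<in> S" "t \<in> S"
  shows "inversion_seq (concat (replicate k [s, t])) = map (\<lambda>i. (s \<otimes> t) [^] i \<otimes> s) [0..<2 * k]"
proof (induction k)
  case (Suc k)
  let ?a = "s \<otimes> t" and ?R = "concat (replicate k [s, t])"
  have a: "?a \<in> carrier W" using assms by auto
  have 1: "?a [^] k \<otimes> s \<otimes> inv (?a [^] k) = ?a [^] (2 * k) \<otimes> s"
    using assms a by (simp add: m_assoc dihedral_swap nat_pow_mult[symmetric] mult_2)
  have 2: "?a [^] k \<otimes> (s \<otimes> t \<otimes> inv s) \<otimes> inv (?a [^] k) = ?a [^] Suc (2 * k) \<otimes> s"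
  proof -
    have "?a [^] k \<otimes> (s \<otimes> t \<otimes> inv s) \<otimes> inv (?a [^] k)
        = ?a [^] k \<otimes> ?a \<otimes> (s \<otimes> inv (?a [^] k))"
      using assms a by (simp add: m_assoc gen_inv)
    also have "\<dots> = ?a [^] Suc k \<otimes> ?a [^] k \<otimes> s"
      using assms a by (simp add: m_assoc dihedral_swap)
    also have "\<dots> = ?a [^] Suc (2 * k) \<otimes> s"
      using a nat_pow_mult[of ?a "Suc k" k] by (simp add: mult_2)
    finally show ?thesis .
  qed
  have "concat (replicate (Suc k) [s, t]) = ?R @ [s, t]"
    by (induction k) auto
  then have "inversion_seq (concat (replicate (Suc k) [s, t])) =
      map (\<lambda>i. ?a [^] i \<otimes> s) [0..<2 * k] @ [?a [^] (2 * k) \<otimes> s, ?a [^] Suc (2 * k) \<otimes> s]"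
    using Suc 1 2 assms alternating_word_subset[OF assms, of k]
    by (simp add: inversion_seq_append alternating_word_prod)
  then show ?case by simp
qed simp

text \<open>The reflections \<open>(s t)\<^sup>i s\<close> for \<open>0 \<le> i < 2 m\<close> are periodic in \<open>i\<close> with period \<open>m\<close>, the order of \<open>s t\<close>,
  so each value is taken an even number of times. If the order is infinite, \<open>m\<close> is \<open>0\<close> and the word is
  empty.\<close>

lemma even_count_relator:
  assumes "s \<in> S" "t \<in> S"
  shows "even (count_list (inversion_seq (concat (replicate (ord (s \<otimes> t)) [s, t]))) r)"
proof -
  let ?a = "s \<otimes> t" let ?m = "ord ?a" let ?f = "\<lambda>i::nat. ?a [^] i \<otimes> s"
  have a: "?a \<in> carrier W" using assms by auto
  have "map ?f [?m..<?m + ?m] = map (\<lambda>i. ?f (i + ?m)) [0..<?m]"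
    using map_add_upt[of ?m ?m] by (metis (no_types, lifting) map_map comp_apply map_cong)
  also have "\<dots> = map ?f [0..<?m]"
    using a by (simp add: nat_pow_mult[symmetric] pow_ord_eq_1)
  finally have "map ?f [0..<2 * ?m] = map ?f [0..<?m] @ map ?f [0..<?m]"
    using upt_add_eq_append[of 0 ?m ?m] by (simp add: mult_2)
  then show ?thesis by (simp add: alternating_inversion_seq[OF assms])
qed

text \<open>A relator has product \<open>\<one>\<close>, so inserting it into a word leaves the contributions of the letters before
  and after it unchanged, and its own contribution is even.\<close>

lemma congruent_parity:
  assumes "coxeter_congruent W S u v" "t \<in> carrier W"
  shows "even (count_list (inversion_seq u) t) = even (count_list (inversion_seq v) t)"
  using assms
proof (induction arbitrary: t)
  case (relation s r u v)
  let ?R = "concat (replicate (ord (s \<otimes> r)) [s, r])"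
  have R: "set ?R \<subseteq> S" "word_prod W ?R = \<one>"
    using relation alternating_word_subset[of s r] alternating_word_prod[of s r] pow_ord_eq_1
    by auto
  have "set (?R @ v) \<subseteq> S" using R relation by auto
  then show ?case using relation R even_count_relator[of s r]
    by (simp add: count_inversion_seq_append del: set_append)
qed auto

text \<open>By \<open>inversion_word\<close> any word for \<open>w\<close> can be used here.\<close>

definition inversion :: "'a \<Rightarrow> 'a \<Rightarrow> bool" where
  "inversion w t \<longleftrightarrow>
    (\<exists>xs. set xs \<subseteq> S \<and> word_prod W xs = w \<and> odd (count_list (inversion_seq xs) t))"

lemma inversion_word:
  assumes "set xs \<subseteq> S" "t \<in> carrier W"
  shows "inversion (word_prod W xs) t \<longleftrightarrow> odd (count_list (inversion_seq xs) t)"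
  using assms congruent_parity[OF presentation] unfolding inversion_def by blast

text \<open>The set of inversions of \<open>x y\<close> is the symmetric difference of that of \<open>x\<close> and the \<open>x\<close>-conjugate of
  that of \<open>y\<close>.\<close>

lemma inversion_mult:
  assumes "x \<in> carrier W" "y \<in> carrier W" "t \<in> carrier W"
  shows "inversion (x \<otimes> y) t \<longleftrightarrow> (inversion x t \<noteq> inversion y (inv x \<otimes> t \<otimes> x))"
proof -
  obtain xs where xs: "set xs \<subseteq> S" "word_prod W xs = x" using ex_word[OF assms(1)] by blast
  obtain ys where ys: "set ys \<subseteq> S" "word_prod W ys = y" using ex_word[OF assms(2)] by blast
  have "set (xs @ ys) \<subseteq> S" "inv x \<otimes> t \<otimes> x \<in> carrier W" using xs ys assms by auto
  then show ?thesis
    using inversion_word[of "xs @ ys" t] inversion_word[of xs t] inversion_word[of ys "inv x \<otimes> t \<otimes> x"]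
      xs ys assms by (auto simp: word_prod_append count_inversion_seq_append)
qed

lemma reflection_closed: "t \<in> reflections W S \<Longrightarrow> t \<in> carrier W"
  unfolding reflections_def by auto

lemma reflection_conj:
  assumes "t \<in> reflections W S" "x \<in> carrier W"
  shows "x \<otimes> t \<otimes> inv x \<in> reflections W S"
proof -
  obtain w s where "w \<in> carrier W" "s \<in> S" "t = w \<otimes> s \<otimes> inv w"
    using assms unfolding reflections_def by auto
  then have "x \<otimes> t \<otimes> inv x = (x \<otimes> w) \<otimes> s \<otimes> inv (x \<otimes> w)" "x \<otimes> w \<in> carrier W" "s \<in> S"
    using assms(2) by (auto simp: m_assoc inv_mult_group)
  then show ?thesis unfolding reflections_def by blast
qed

lemma reflection_gen: "s \<in> S \<Longrightarrow> s \<in> reflections W S"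
  unfolding reflections_def
  by (rule CollectI, rule exI[of _ \<one>], rule exI[of _ s]) auto

lemma reflection_square: assumes "t \<in> reflections W S" shows "t \<otimes> t = \<one>"
proof -
  obtain w s where "w \<in> carrier W" "s \<in> S" "t = w \<otimes> s \<otimes> inv w"
    using assms unfolding reflections_def by auto
  then show ?thesis
    using gen_cancel_left[of s "inv w"] inv_cancel_left(2)[of w "s \<otimes> inv w"]
    by (simp add: m_assoc)
qed

lemma inversion_gen: assumes "s \<in> S" shows "inversion s s"
  using inversion_word[of "[s]" s] assms by simp

lemma inversion_one: "t \<in> carrier W \<Longrightarrow> \<not> inversion \<one> t"
  using inversion_word[of "[]" t] by simp

text \<open>Split \<open>t = w s w\<^sup>-\<^sup>1\<close> by the cocycle rule: the contributions of \<open>w\<close> and \<open>w\<^sup>-\<^sup>1\<close> cancel, because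
  \<open>w w\<^sup>-\<^sup>1 = \<one>\<close> has no inversions, and the middle letter \<open>s\<close> contributes one.\<close>

lemma inversion_reflection: assumes "t \<in> reflections W S" shows "inversion t t"
proof -
  obtain w s where w: "w \<in> carrier W" "s \<in> S" and t: "t = w \<otimes> s \<otimes> inv w"
    using assms unfolding reflections_def by auto
  have tc: "t \<in> carrier W" using t w by auto
  have 1: "inv w \<otimes> t \<otimes> w = s" using t w by (simp add: m_assoc inv_cancel_left)
  have 2: "inv s \<otimes> s \<otimes> s = s" using w by auto
  have "inversion w t = inversion (inv w) s"
    using inversion_mult[of w "inv w" t] inversion_one[OF tc] w tc 1 by auto
  moreover have "inversion t t = (inversion w t \<noteq> inversion (s \<otimes> inv w) s)"
    using inversion_mult[of w "s \<otimes> inv w" t] w tc 1 t by (simp add: m_assoc)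
  moreover have "inversion (s \<otimes> inv w) s = (inversion s s \<noteq> inversion (inv w) s)"
    using inversion_mult[of s "inv w" s] w 2 by simp
  ultimately show ?thesis using inversion_gen[OF w(2)] by simp
qed

lemma inversion_seq_delete:
  assumes "set xs \<subseteq> S" "t \<in> set (inversion_seq xs)"
  shows "\<exists>ys s zs. xs = ys @ s # zs \<and> t \<otimes> word_prod W xs = word_prod W (ys @ zs)"
  using assms
proof (induction xs arbitrary: t)
  case (Cons s xs)
  have s: "s \<in> S" "set xs \<subseteq> S" using Cons.prems by auto
  show ?case
  proof (cases "t = s")
    case True
    then show ?thesis using s
      by (intro exI[of _ "[]"] exI[of _ s] exI[of _ xs]) (auto simp: gen_cancel_left)
  next
    case False
    then obtain r where r: "r \<in> set (inversion_seq xs)" "t = s \<otimes> r \<otimes> inv s"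
      using Cons.prems by auto
    obtain ys q zs where y: "xs = ys @ q # zs" "r \<otimes> word_prod W xs = word_prod W (ys @ zs)"
      using Cons.IH[OF s(2) r(1)] by blast
    have "r \<in> carrier W" using r s inversion_seq_closed by auto
    then have "t \<otimes> word_prod W (s # xs) = word_prod W ((s # ys) @ zs)"
      using r s y by (simp add: m_assoc inv_cancel_left)
    then show ?thesis using y(1) by (metis append_Cons)
  qed
qed simp

lemma inversion_delete:
  assumes "set xs \<subseteq> S" "t \<in> carrier W" "inversion (word_prod W xs) t"
  shows "\<exists>ys s zs. xs = ys @ s # zs \<and> t \<otimes> word_prod W xs = word_prod W (ys @ zs)"
proof -
  have "t \<in> set (inversion_seq xs)"
    using assms inversion_word by (metis count_list_0_iff even_zero)
  then show ?thesis using inversion_seq_delete assms(1) by blast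
qed

lemma inversion_less:
  assumes "w \<in> carrier W" "t \<in> carrier W" "inversion w t"
  shows "ell (t \<otimes> w) < ell w"
proof -
  obtain xs where xs: "set xs \<subseteq> S" "word_prod W xs = w" "length xs = ell w"
    using ex_reduced_word[OF assms(1)] by blast
  obtain ys s zs where "xs = ys @ s # zs" "t \<otimes> w = word_prod W (ys @ zs)"
    using inversion_delete[OF xs(1) assms(2)] assms xs by auto
  then show ?thesis using xs ell_le[of "ys @ zs"] by auto
qed

text \<open>By the cocycle rule, \<open>t\<close> is an inversion of exactly one of \<open>w\<close> and \<open>t w\<close>.\<close>

lemma not_inversion_greater:
  assumes "w \<in> carrier W" "t \<in> reflections W S" "\<not> inversion w t"
  shows "ell w < ell (t \<otimes> w)"
proof -
  have t: "t \<in> carrier W" "t \<otimes> t = \<one>" "inv t \<otimes> t \<otimes> t = t"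
    using assms reflection_closed reflection_square by auto
  have "inversion (t \<otimes> w) t"
    using inversion_mult[of t w t] inversion_reflection[OF assms(2)] t assms by simp
  from inversion_less[OF _ t(1) this] show ?thesis
    using t assms by (simp flip: m_assoc)
qed

lemma inversion_iff:
  assumes "w \<in> carrier W" "t \<in> reflections W S"
  shows "inversion w t \<longleftrightarrow> ell (t \<otimes> w) < ell w"
  using inversion_less[OF assms(1) reflection_closed[OF assms(2)]] not_inversion_greater[OF assms] less_asym
  by blast

text \<open>The strong exchange property, in a form that keeps track of the letters: a reflection that shortens an
  element of \<open>W\<^sub>I\<close> does not lead out of \<open>W\<^sub>I\<close>.\<close>

lemma exchange_parabolic:
  assumes "I \<subseteq> S" "set xs \<subseteq> I" "t \<in> reflections W S"
    "ell (t \<otimes> word_prod W xs) < ell (word_prod W xs)"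
  shows "\<exists>ys. set ys \<subseteq> I \<and> length ys < length xs \<and> t \<otimes> word_prod W xs = word_prod W ys"
proof -
  have xs: "set xs \<subseteq> S" using assms by auto
  have "inversion (word_prod W xs) t" using inversion_iff assms xs by auto
  then obtain ys s zs where "xs = ys @ s # zs" "t \<otimes> word_prod W xs = word_prod W (ys @ zs)"
    using inversion_delete[OF xs reflection_closed[OF assms(3)]] by blast
  then show ?thesis using assms(2) by (intro exI[of _ "ys @ zs"]) auto
qed

lemma ell_reflection_neq:
  assumes "w \<in> carrier W" "t \<in> reflections W S"
  shows "ell (t \<otimes> w) \<noteq> ell w"
  using inversion_iff[OF assms] not_inversion_greater[OF assms] less_irrefl by metis

lemma right_as_left:
  assumes "w \<in> carrier W" "s \<in> carrier W"
  shows "w \<otimes> s \<otimes> inv w \<otimes> w = w \<otimes> s"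
  using assms by (simp add: m_assoc)

lemma ell_gen_right:
  assumes "w \<in> carrier W" "s \<in> S"
  shows "ell (w \<otimes> s) = ell w + 1 \<or> ell w = ell (w \<otimes> s) + 1"
proof -
  have "ell (w \<otimes> s) \<noteq> ell w"
    using ell_reflection_neq[OF assms(1) reflection_conj[OF reflection_gen assms(1)], of s]
      right_as_left[of w s] assms by auto
  moreover have "ell (w \<otimes> s) \<le> ell w + 1" "ell (w \<otimes> s \<otimes> s) \<le> ell (w \<otimes> s) + 1"
    using ell_mult[of w s] ell_mult[of "w \<otimes> s" s] assms ell_gen by auto
  ultimately show ?thesis using gen_cancel_right assms by auto
qed

lemma ell_gen_left:
  assumes "w \<in> carrier W" "s \<in> S"
  shows "ell (s \<otimes> w) = ell w + 1 \<or> ell w = ell (s \<otimes> w) + 1"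
  using ell_gen_right[of "inv w" s] ell_inv[of w] ell_inv[of "s \<otimes> w"] assms
  by (simp add: inv_mult_group gen_inv)

text \<open>The reflection \<open>x y s (x y)\<^sup>-\<^sup>1\<close> is an inversion of \<open>x y\<close>, hence by the cocycle rule an inversion of \<open>x\<close>,
  or its conjugate \<open>y s y\<^sup>-\<^sup>1\<close> is one of \<open>y\<close>.\<close>

lemma descent_split:
  assumes "x \<in> carrier W" "y \<in> carrier W" "s \<in> S" "ell (x \<otimes> y \<otimes> s) < ell (x \<otimes> y)"
  shows "ell (y \<otimes> s) < ell y \<or> ell (x \<otimes> (y \<otimes> s \<otimes> inv y)) < ell x"
proof -
  let ?t = "x \<otimes> y \<otimes> s \<otimes> inv (x \<otimes> y)" and ?r = "y \<otimes> s \<otimes> inv y"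
  have t: "?t \<in> reflections W S" and r: "?r \<in> reflections W S"
    using assms reflection_conj reflection_gen by auto
  have "inversion (x \<otimes> y) ?t"
    using inversion_iff[OF _ t] assms right_as_left[of "x \<otimes> y" s] by auto
  moreover have "inv x \<otimes> ?t \<otimes> x = ?r"
    using assms by (simp add: m_assoc inv_cancel_left inv_mult_group)
  ultimately have "inversion x ?t \<or> inversion y ?r"
    using inversion_mult[of x y ?t] assms by auto
  moreover have "?t \<otimes> x = x \<otimes> ?r"
    using assms by (simp add: m_assoc inv_mult_group)
  ultimately show ?thesis
    using inversion_iff[OF _ t, of x] inversion_iff[OF _ r, of y] right_as_left[of y s] assms
    by auto
qed

section \<open>Parabolic subgroups and descents\<close>

text \<open>The length of an element of \<open>W\<^sub>I\<close> is the same for the generators \<open>I\<close> and \<open>S\<close>: in a word over \<open>I\<close>,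
  each new letter either prolongs a reduced word or, by exchange, cancels one of its letters.\<close>

lemma parabolic_reduced_word:
  assumes "I \<subseteq> S" "v \<in> par I"
  shows "\<exists>xs. set xs \<subseteq> I \<and> word_prod W xs = v \<and> length xs = ell v"
proof -
  \<comment> \<open>The claim is proved for the element spelled by an arbitrary word over \<open>I\<close>, by induction on that word.\<close>
  have "\<exists>ys. set ys \<subseteq> I \<and> word_prod W ys = word_prod W xs \<and> length ys = ell (word_prod W xs)"
    if "set xs \<subseteq> I" for xs
    using that
  proof (induction xs)
    case (Cons s xs)
    let ?w = "word_prod W xs"
    have s: "s \<in> I" "s \<in> S" and w: "?w \<in> carrier W" using Cons.prems assms(1) by auto
    obtain ys where ys: "set ys \<subseteq> I" "word_prod W ys = ?w" "length ys = ell ?w"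
      using Cons by auto
    from ell_gen_left[OF w s(2)] show ?case
    proof
      assume "ell (s \<otimes> ?w) = ell ?w + 1"
      then show ?thesis using ys s by (intro exI[of _ "s # ys"]) simp
    next
      assume *: "ell ?w = ell (s \<otimes> ?w) + 1"
      then have "ell (s \<otimes> word_prod W ys) < ell (word_prod W ys)" using ys by simp
      from exchange_parabolic[OF assms(1) ys(1) reflection_gen[OF s(2)] this]
      obtain zs where zs: "set zs \<subseteq> I" "length zs < length ys" "s \<otimes> ?w = word_prod W zs"
        using ys by auto
      moreover have "ell (s \<otimes> ?w) \<le> length zs" using zs assms(1) ell_le[of zs] by simp
      ultimately show ?thesis using * ys by (intro exI[of _ zs]) simp
    qed
  qed simp
  then show ?thesis using parabolic_word[OF assms] by auto
qed

lemma parabolic_length_induct [consumes 2, case_names one step]: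
  assumes "I \<subseteq> S" "v \<in> par I"
    and one: "Q \<one>"
    and step: "\<And>v s. \<lbrakk>v \<in> par I; s \<in> I; ell (v \<otimes> s) = ell v + 1; Q v\<rbrakk> \<Longrightarrow> Q (v \<otimes> s)"
  shows "Q v"
  using assms(2)
proof (induction "ell v" arbitrary: v)
  case 0
  then show ?case using ell_eq_0[OF parabolic_closed[OF assms(1)]] one by auto
next
  case (Suc n)
  obtain xs where xs: "set xs \<subseteq> I" "word_prod W xs = v" "length xs = ell v"
    using parabolic_reduced_word[OF assms(1) Suc.prems] by blast
  then obtain ys s where ys: "xs = ys @ [s]"
    using Suc(2) by (metis length_0_conv nat.distinct(1) rev_exhaust)
  have I: "set ys \<subseteq> S" "set ys \<subseteq> I" "s \<in> I" "s \<in> S" using xs ys assms(1) by auto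
  have v: "v = word_prod W ys \<otimes> s" using xs ys I by (auto simp: word_prod_append)
  have "ell (word_prod W ys) \<le> n" using ell_le[OF I(1)] xs ys Suc(2) by simp
  moreover have "ell v \<le> ell (word_prod W ys) + 1"
    unfolding v using ell_mult[of "word_prod W ys" s] I ell_gen by auto
  ultimately have e: "ell (word_prod W ys) = n" using Suc(2) by simp
  have p: "word_prod W ys \<in> par I" using word_in_parabolic[OF I(2)] .
  show ?case
    using step[OF p I(3) _ Suc(1)[OF e[symmetric] p]] e Suc(2) v by simp
qed

lemma gen_in_parabolic:
  assumes "I \<subseteq> S" "s \<in> par I" "ell s = 1"
  shows "s \<in> I"
proof -
  obtain xs where xs: "set xs \<subseteq> I" "word_prod W xs = s" "length xs = 1"
    using parabolic_reduced_word[OF assms(1,2)] assms(3) by auto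
  then obtain a where "xs = [a]" by (auto simp: length_Suc_conv)
  then show ?thesis using xs assms(1) by auto
qed

text \<open>The four predicates record one-sided ascents and descents: \<open>right_min I a\<close> characterizes the shortest
  element of \<open>a W\<^sub>I\<close>, and \<open>right_max I a\<close> the longest one if \<open>W\<^sub>I\<close> is finite.\<close>

definition right_min :: "'a set \<Rightarrow> 'a \<Rightarrow> bool" where
  "right_min I a \<longleftrightarrow> (\<forall>s\<in>I. ell a < ell (a \<otimes> s))"

definition left_min :: "'a set \<Rightarrow> 'a \<Rightarrow> bool" where
  "left_min J a \<longleftrightarrow> (\<forall>s\<in>J. ell a < ell (s \<otimes> a))"

definition right_max :: "'a set \<Rightarrow> 'a \<Rightarrow> bool" where
  "right_max I a \<longleftrightarrow> (\<forall>s\<in>I. ell (a \<otimes> s) < ell a)"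

definition left_max :: "'a set \<Rightarrow> 'a \<Rightarrow> bool" where
  "left_max J a \<longleftrightarrow> (\<forall>s\<in>J. ell (s \<otimes> a) < ell a)"

lemma ell_left_as_right:
  "s \<in> S \<Longrightarrow> a \<in> carrier W \<Longrightarrow> ell (inv a \<otimes> s) = ell (s \<otimes> a)"
  using ell_inv[of "s \<otimes> a"] by (simp add: inv_mult_group gen_inv)

lemma left_min_inv:
  "J \<subseteq> S \<Longrightarrow> a \<in> carrier W \<Longrightarrow> right_min J (inv a) \<longleftrightarrow> left_min J a"
  unfolding left_min_def right_min_def using ell_left_as_right ell_inv by (metis subsetD)

lemma left_max_inv:
  "J \<subseteq> S \<Longrightarrow> a \<in> carrier W \<Longrightarrow> right_max J (inv a) \<longleftrightarrow> left_max J a"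
  unfolding left_max_def right_max_def using ell_left_as_right ell_inv by (metis subsetD)

text \<open>A failure at \<open>v s\<close> would, by \<open>descent_split\<close>, shorten \<open>a\<close> within its coset by the reflection
  \<open>v s v\<^sup>-\<^sup>1 \<in> W\<^sub>I\<close>.\<close>

lemma coset_shortest_add:
  assumes "I \<subseteq> S" "a \<in> carrier W" and least: "\<And>v. v \<in> par I \<Longrightarrow> ell a \<le> ell (a \<otimes> v)"
    and "v \<in> par I"
  shows "ell (a \<otimes> v) = ell a + ell v"
  using assms(1,4)
proof (induction rule: parabolic_length_induct)
  case one
  then show ?case using assms(2) by simp
next
  case (step v s)
  have c: "v \<in> carrier W" "s \<in> S" using step parabolic_closed assms(1) by auto
  have "v \<otimes> s \<otimes> inv v \<in> par I"
    using step assms(1) by (simp add: parabolic_mult parabolic_gen parabolic_inv)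
  then have "\<not> ell (a \<otimes> v \<otimes> s) < ell (a \<otimes> v)"
    using descent_split[OF assms(2) c] step(3) least[of "v \<otimes> s \<otimes> inv v"] by auto
  then show ?case
    using ell_gen_right[of "a \<otimes> v" s] c assms(2) step by (auto simp: m_assoc)
qed

lemma ex_right_min:
  assumes "I \<subseteq> S" "w \<in> carrier W"
  shows "\<exists>a v. a \<in> carrier W \<and> v \<in> par I \<and> w = a \<otimes> v \<and> right_min I a \<and>
    (\<forall>u\<in>par I. ell (a \<otimes> u) = ell a + ell u)"
proof -
  obtain v where v: "v \<in> par I" and least: "\<And>u. u \<in> par I \<Longrightarrow> ell (w \<otimes> v) \<le> ell (w \<otimes> u)"
    using ex_has_least_nat[of "\<lambda>u. u \<in> par I" \<one> "\<lambda>u. ell (w \<otimes> u)"] parabolic_one by blast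
  have vc: "v \<in> carrier W" using parabolic_closed[OF assms(1) v] .
  have *: "ell (w \<otimes> v) \<le> ell (w \<otimes> v \<otimes> u)" if u: "u \<in> par I" for u
    using least[OF parabolic_mult[OF v u]] vc parabolic_closed[OF assms(1) u] assms(2)
    by (simp add: m_assoc)
  have add: "\<forall>u\<in>par I. ell (w \<otimes> v \<otimes> u) = ell (w \<otimes> v) + ell u"
    using coset_shortest_add[OF assms(1) _ *] vc assms(2) by auto
  moreover have "right_min I (w \<otimes> v)"
    unfolding right_min_def using add ell_gen parabolic_gen assms(1) by fastforce
  moreover have "w = w \<otimes> v \<otimes> inv v" using assms(2) vc by (simp add: m_assoc)
  ultimately show ?thesis
    using parabolic_inv[OF assms(1) v] vc assms(2)
    by (intro exI[of _ "w \<otimes> v"] exI[of _ "inv v"]) auto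
qed

text \<open>The shortest element \<open>b\<close> of the coset satisfies this, and if \<open>a = b u\<close> with \<open>u \<noteq> \<one>\<close>, then the last
  letter of a reduced word of \<open>u\<close> is a descent of \<open>a\<close>.\<close>

lemma right_min_add:
  assumes "I \<subseteq> S" "a \<in> carrier W" "right_min I a" "v \<in> par I"
  shows "ell (a \<otimes> v) = ell a + ell v"
proof -
  obtain b u where b: "b \<in> carrier W" "u \<in> par I" "a = b \<otimes> u"
    and add: "\<forall>u\<in>par I. ell (b \<otimes> u) = ell b + ell u"
    using ex_right_min[OF assms(1,2)] by blast
  have "a = b \<or> (\<exists>s\<in>I. ell (a \<otimes> s) < ell a)"
    using assms(1) b(2) unfolding b(3)
  proof (induction rule: parabolic_length_induct)
    case one
    then show ?case using b by simp
  next
    case (step u s)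
    have c: "u \<in> carrier W" "s \<in> S" using step parabolic_closed assms(1) by auto
    have "u \<otimes> s \<in> par I" using step by (simp add: parabolic_mult parabolic_gen)
    then have "ell (b \<otimes> (u \<otimes> s)) = ell b + (ell u + 1)" "ell (b \<otimes> u) = ell b + ell u"
      using step add by auto
    moreover have "b \<otimes> (u \<otimes> s) \<otimes> s = b \<otimes> u"
      using b c by (simp add: m_assoc gen_square)
    ultimately have "ell (b \<otimes> (u \<otimes> s) \<otimes> s) < ell (b \<otimes> (u \<otimes> s))" by simp
    then show ?case using step by blast
  qed
  then have "a = b" using assms(3) unfolding right_min_def by force
  then show ?thesis using add assms(4) by simp
qed

lemma left_min_add:
  assumes "J \<subseteq> S" "a \<in> carrier W" "left_min J a" "u \<in> par J"
  shows "ell (u \<otimes> a) = ell u + ell a"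
proof -
  have u: "u \<in> carrier W" using parabolic_closed assms by blast
  have "ell (inv a \<otimes> inv u) = ell (inv a) + ell (inv u)"
    using right_min_add[of J "inv a" "inv u"] assms left_min_inv parabolic_inv by auto
  then show ?thesis
    using u assms(2) ell_inv[of "u \<otimes> a"] ell_inv[of u] ell_inv[of a] by (simp add: inv_mult_group)
qed

text \<open>If every \<open>s \<in> I\<close> is a right descent of \<open>z\<close>, then \<open>z\<close> has a reduced word ending in any prescribed
  reduced word over \<open>I\<close>. The suffix is built up letter by letter: when \<open>s\<close> is not a descent of the suffix
  \<open>u\<close>, \<open>descent_split\<close> moves the loss of length to the complementary prefix.\<close>

lemma right_max_split:
  assumes "I \<subseteq> S" "z \<in> carrier W" "right_max I z" "u \<in> par I"
  shows "ell z = ell (z \<otimes> inv u) + ell u"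
  using assms(1,4)
proof (induction rule: parabolic_length_induct)
  case one
  then show ?case using assms(2) by simp
next
  case (step u s)
  have c: "u \<in> carrier W" "s \<in> S" using step parabolic_closed assms(1) by auto
  let ?c = "z \<otimes> inv u" and ?d = "z \<otimes> inv (u \<otimes> s)"
  have cu: "?c \<otimes> u = z" using c assms(2) by (simp add: m_assoc)
  have "?c \<otimes> (u \<otimes> s \<otimes> inv u) = ?d"
    using c assms(2) by (simp add: m_assoc inv_mult_group gen_inv inv_cancel_left)
  moreover have "ell (z \<otimes> s) < ell z" using assms(3) step(2) unfolding right_max_def by blast
  ultimately have "ell ?d < ell ?c"
    using descent_split[of ?c u s] cu c assms(2) step(3) by auto
  moreover have "ell z \<le> ell ?d + ell (u \<otimes> s)"
    using ell_mult[of ?d "u \<otimes> s"] c assms(2) by (simp add: m_assoc)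
  ultimately show ?case using step by simp
qed

section \<open>Longest elements\<close>

lemma finitary_subset_gens: "finitary W S I \<Longrightarrow> I \<subseteq> S"
  unfolding finitary_def by simp

lemma finitary_mono: "finitary W S I \<Longrightarrow> K \<subseteq> I \<Longrightarrow> finitary W S K"
  unfolding finitary_def using mono_generate[of K I] finite_subset by blast

lemma longest_right_max:
  assumes "I \<subseteq> S" "w \<in> par I" "\<And>v. v \<in> par I \<Longrightarrow> ell v \<le> ell w"
  shows "right_max I w"
  unfolding right_max_def
proof
  fix s assume "s \<in> I"
  then show "ell (w \<otimes> s) < ell w"
    using assms(3)[OF parabolic_mult[OF assms(2) parabolic_gen]] assms(1)
      ell_gen_right[OF parabolic_closed[OF assms(1,2)], of s] by fastforce
qed

lemma right_max_unique:
  assumes "I \<subseteq> S" "w \<in> par I" "right_max I w" "v \<in> par I" "ell w \<le> ell v"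
  shows "w = v"
proof -
  have c: "w \<in> carrier W" "v \<in> carrier W" using parabolic_closed assms by auto
  have "ell (w \<otimes> inv v) = 0"
    using right_max_split[OF assms(1) c(1) assms(3,4)] assms(5) by simp
  then have "w \<otimes> inv v = \<one>" using ell_eq_0 c by auto
  then show ?thesis using c inv_solve_right[of \<one> w v] by simp
qed

lemma longest:
  assumes "finitary W S I"
  shows longest_in: "longest_elt W S I \<in> par I"
    and longest_ge: "\<And>v. v \<in> par I \<Longrightarrow> ell v \<le> ell (longest_elt W S I)"
proof -
  have I: "I \<subseteq> S" using finitary_subset_gens[OF assms] .
  let ?P = "\<lambda>w. w \<in> par I \<and> (\<forall>v\<in>par I. ell v \<le> ell w)"
  have fin: "finite (ell ` par I)" and ne: "ell ` par I \<noteq> {}"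
    using assms parabolic_one unfolding finitary_def by blast+
  obtain w where "w \<in> par I" "ell w = Max (ell ` par I)"
    using Max_in[OF fin ne] by (metis imageE)
  then have w: "?P w" using Max_ge[OF fin] by simp
  have "?P (longest_elt W S I)" unfolding longest_elt_def
  proof (rule theI[of ?P])
    show "?P w" using w .
    show "w' = w" if "?P w'" for w'
      using right_max_unique[OF I, of w' w] longest_right_max[OF I, of w'] that w by blast
  qed
  then show "longest_elt W S I \<in> par I"
    "\<And>v. v \<in> par I \<Longrightarrow> ell v \<le> ell (longest_elt W S I)" by auto
qed

lemma longest_closed: "finitary W S I \<Longrightarrow> longest_elt W S I \<in> carrier W"
  using longest_in finitary_subset_gens parabolic_closed by blast

lemma longest_max: "finitary W S I \<Longrightarrow> right_max I (longest_elt W S I)"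
  using longest_right_max longest_in longest_ge finitary_subset_gens by blast

lemma longest_unique:
  assumes "finitary W S I" "w \<in> par I" "right_max I w"
  shows "w = longest_elt W S I"
  using assms right_max_unique[OF finitary_subset_gens[OF assms(1)] assms(2,3)] right_max_unique
    longest_in longest_ge longest_max finitary_subset_gens by (metis nat_le_linear)

lemma longest_inv:
  assumes "finitary W S I" shows "inv (longest_elt W S I) = longest_elt W S I"
proof -
  have I: "I \<subseteq> S" using finitary_subset_gens[OF assms] .
  have "right_max I (inv (longest_elt W S I))"
    using longest_right_max[OF I parabolic_inv[OF I longest_in[OF assms]]]
      ell_inv[OF longest_closed[OF assms]] longest_ge[OF assms] by simp
  then show ?thesis using longest_unique[OF assms] parabolic_inv[OF I longest_in[OF assms]] by blast
qed

lemma longest_left_max: "finitary W S I \<Longrightarrow> left_max I (longest_elt W S I)"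
  using longest_inv longest_max left_max_inv finitary_subset_gens longest_closed by metis

lemma longest_left_unique:
  assumes "finitary W S I" "w \<in> par I" "left_max I w"
  shows "w = longest_elt W S I"
proof -
  have I: "I \<subseteq> S" using finitary_subset_gens[OF assms(1)] .
  have w: "w \<in> carrier W" using parabolic_closed[OF I assms(2)] .
  have "inv w = longest_elt W S I"
    using longest_unique[OF assms(1) parabolic_inv[OF I assms(2)]] left_max_inv[OF I w] assms(3)
    by simp
  then show ?thesis using w longest_inv[OF assms(1)] by (metis inv_inv)
qed

lemma longest_split_right:
  assumes "finitary W S I" "u \<in> par I"
  shows "ell (longest_elt W S I) = ell (longest_elt W S I \<otimes> inv u) + ell u"
  using right_max_split[OF _ longest_closed longest_max assms(2)] assms finitary_subset_gens by simp

lemma longest_split_left: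
  assumes "finitary W S I" "u \<in> par I"
  shows "ell (longest_elt W S I) = ell u + ell (inv u \<otimes> longest_elt W S I)"
proof -
  have I: "I \<subseteq> S" using finitary_subset_gens[OF assms(1)] .
  let ?w = "longest_elt W S I"
  have c: "u \<in> carrier W" "?w \<in> carrier W"
    using parabolic_closed[OF I assms(2)] longest_closed[OF assms(1)] .
  have "ell (inv u \<otimes> ?w) = ell (?w \<otimes> u)"
    using ell_inv[of "inv u \<otimes> ?w"] c longest_inv[OF assms(1)] by (simp add: inv_mult_group)
  then show ?thesis
    using longest_split_right[OF assms(1) parabolic_inv[OF I assms(2)]] c ell_inv[of u] by simp
qed

text \<open>If the two longest elements have equal length, they coincide, so \<open>w\<^sub>K\<^sub>'\<close> lies in \<open>W\<^sub>K\<close>. Every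
  \<open>s \<in> K'\<close> shortens it, so by exchange \<open>w\<^sub>K\<^sub>' s\<close> lies in \<open>W\<^sub>K\<close> too, and hence so does \<open>s\<close>.\<close>

lemma longest_length_inj:
  assumes "finitary W S K'" "K \<subseteq> K'" "ell (longest_elt W S K) = ell (longest_elt W S K')"
  shows "K = K'"
proof -
  have fK: "finitary W S K" using finitary_mono assms by blast
  have K: "K \<subseteq> S" "K' \<subseteq> S" using finitary_subset_gens fK assms by auto
  let ?w = "longest_elt W S K'"
  have "longest_elt W S K \<in> par K'" using mono_generate[OF assms(2)] longest_in[OF fK] by blast
  then have "?w = longest_elt W S K"
    using right_max_unique[OF K(2) longest_in longest_max] assms by auto
  then have w: "?w \<in> par K" using longest_in[OF fK] by simp
  then obtain xs where xs: "set xs \<subseteq> K" "word_prod W xs = ?w" using parabolic_word[OF K(1)] by blast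
  have wc: "?w \<in> carrier W" using longest_closed assms by blast
  have "s \<in> K" if s: "s \<in> K'" for s
  proof -
    have sS: "s \<in> S" using s K by auto
    let ?t = "?w \<otimes> s \<otimes> inv ?w"
    have t: "?t \<in> reflections W S" using reflection_conj[OF reflection_gen[OF sS] wc] .
    have "?t \<otimes> ?w = ?w \<otimes> s" using right_as_left wc sS by auto
    moreover have "ell (?w \<otimes> s) < ell ?w" using longest_max[OF assms(1)] s unfolding right_max_def by blast
    ultimately obtain ys where "set ys \<subseteq> K" "?w \<otimes> s = word_prod W ys"
      using exchange_parabolic[OF K(1) xs(1) t] xs(2) by auto
    then have "?w \<otimes> s \<in> par K" using word_in_parabolic by simp
    then have "inv ?w \<otimes> (?w \<otimes> s) \<in> par K" using parabolic_mult parabolic_inv[OF K(1) w] by blast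
    then have "s \<in> par K" using wc sS by (simp add: inv_cancel_left)
    then show ?thesis using gen_in_parabolic[OF K(1)] ell_gen[OF sS] by blast
  qed
  then show ?thesis using assms(2) by blast
qed

section \<open>The structure of a double coset\<close>

abbreviation dcoset :: "'a set \<Rightarrow> 'a set \<Rightarrow> 'a \<Rightarrow> 'a set" where
  "dcoset J I w \<equiv> par J <#>\<^bsub>W\<^esub> {w} <#>\<^bsub>W\<^esub> par I"

abbreviation redundancy :: "'a set \<Rightarrow> 'a set \<Rightarrow> 'a \<Rightarrow> 'a set" where
  "redundancy J I x \<equiv> J \<inter> {x \<otimes> s \<otimes> inv x | s. s \<in> I}"

lemma in_dcoset: "z \<in> dcoset J I w \<longleftrightarrow> (\<exists>u\<in>par J. \<exists>v\<in>par I. z = u \<otimes> w \<otimes> v)"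
  unfolding set_mult_def by blast

lemma dcoset_self:
  assumes "w \<in> carrier W" shows "w \<in> dcoset J I w"
  unfolding in_dcoset using parabolic_one[of J] parabolic_one[of I] assms
  by (intro bexI[of _ \<one>]) auto

lemma dcoset_closed:
  assumes "J \<subseteq> S" "I \<subseteq> S" "w \<in> carrier W" "z \<in> dcoset J I w"
  shows "z \<in> carrier W"
  using assms parabolic_closed unfolding in_dcoset by blast

lemma dcoset_mult:
  assumes "J \<subseteq> S" "I \<subseteq> S" "w \<in> carrier W" "z \<in> dcoset J I w" "a \<in> par J" "b \<in> par I"
  shows "a \<otimes> z \<otimes> b \<in> dcoset J I w"
proof -
  obtain u v where uv: "u \<in> par J" "v \<in> par I" "z = u \<otimes> w \<otimes> v"
    using assms(4) unfolding in_dcoset by blast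
  have c: "u \<in> carrier W" "v \<in> carrier W" "a \<in> carrier W" "b \<in> carrier W"
    using uv assms parabolic_closed by auto
  have "a \<otimes> z \<otimes> b = (a \<otimes> u) \<otimes> w \<otimes> (v \<otimes> b)" using uv c assms(3) by (simp add: m_assoc)
  then show ?thesis unfolding in_dcoset using parabolic_mult uv assms by blast
qed

lemma dcoset_left:
  assumes "J \<subseteq> S" "I \<subseteq> S" "w \<in> carrier W" "z \<in> dcoset J I w" "a \<in> par J"
  shows "a \<otimes> z \<in> dcoset J I w"
  using dcoset_mult[OF assms parabolic_one] dcoset_closed[OF assms(1-4)]
    parabolic_closed[OF assms(1,5)] by simp

lemma dcoset_right:
  assumes "J \<subseteq> S" "I \<subseteq> S" "w \<in> carrier W" "z \<in> dcoset J I w" "b \<in> par I"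
  shows "z \<otimes> b \<in> dcoset J I w"
  using dcoset_mult[OF assms(1-4) parabolic_one assms(5)] dcoset_closed[OF assms(1-4)]
    parabolic_closed[OF assms(2,5)] by simp

lemma dcoset_eq:
  assumes "J \<subseteq> S" "I \<subseteq> S" "w \<in> carrier W" "z \<in> dcoset J I w"
  shows "dcoset J I z = dcoset J I w"
proof -
  have z: "z \<in> carrier W" using dcoset_closed assms by blast
  obtain u v where uv: "u \<in> par J" "v \<in> par I" "z = u \<otimes> w \<otimes> v"
    using assms(4) unfolding in_dcoset by blast
  have c: "u \<in> carrier W" "v \<in> carrier W" using uv assms parabolic_closed by auto
  have "w = inv u \<otimes> z \<otimes> inv v" using uv c assms(3) by (simp add: m_assoc inv_cancel_left)
  then have "w \<in> dcoset J I z"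
    unfolding in_dcoset using parabolic_inv uv assms(1,2) by blast
  then have w: "a \<otimes> w \<otimes> b \<in> dcoset J I z" if "a \<in> par J" "b \<in> par I" for a b
    using dcoset_mult[OF assms(1,2) z] that by blast
  have "a \<otimes> z \<otimes> b \<in> dcoset J I w" if "a \<in> par J" "b \<in> par I" for a b
    using dcoset_mult[OF assms] that by blast
  with w show ?thesis
    unfolding set_eq_iff by (metis in_dcoset)
qed

lemma conj_redundancy:
  assumes "J \<subseteq> S" "I \<subseteq> S" "x \<in> carrier W" "k \<in> par (redundancy J I x)"
  shows "inv x \<otimes> k \<otimes> x \<in> par I"
proof -
  have K: "redundancy J I x \<subseteq> S" using assms(1) by auto
  from K assms(4) show ?thesis
  proof (induction rule: parabolic_length_induct)
    case one
    then show ?case using assms(3) parabolic_one by simp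
  next
    case (step k s)
    obtain r where r: "r \<in> I" "s = x \<otimes> r \<otimes> inv x" "s \<in> S" using step(2) assms(1) by auto
    have c: "k \<in> carrier W" "r \<in> S" using step(1) r(1) K parabolic_closed assms(2) by auto
    have "inv x \<otimes> (k \<otimes> s) \<otimes> x = (inv x \<otimes> k \<otimes> x) \<otimes> r"
      using r(2) c assms(3) by (simp add: m_assoc)
    then show ?case using step r(1) by (simp add: parabolic_mult parabolic_gen)
  qed
qed

text \<open>Let \<open>s \<in> I\<close> be a descent of \<open>u x\<close>. It is not one of \<open>x\<close>, so the reflection \<open>r = x s x\<^sup>-\<^sup>1\<close> shortens \<open>u\<close>
  and therefore lies in \<open>W\<^sub>J\<close>. From \<open>r x = x s\<close> and additivity of lengths it has length one, so
  \<open>r \<in> K\<close>, and this contradicts the minimality of \<open>u\<close> modulo \<open>W\<^sub>K\<close>.\<close>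

lemma right_min_translate:
  assumes "J \<subseteq> S" "I \<subseteq> S" "x \<in> carrier W" "left_min J x" "right_min I x"
    and "u \<in> par J" "right_min (redundancy J I x) u"
  shows "right_min I (u \<otimes> x)"
  unfolding right_min_def
proof (rule ballI, rule ccontr)
  fix s assume s: "s \<in> I" and neg: "\<not> ell (u \<otimes> x) < ell (u \<otimes> x \<otimes> s)"
  have c: "u \<in> carrier W" "s \<in> S" using assms(1,2,6) s parabolic_closed by auto
  let ?r = "x \<otimes> s \<otimes> inv x"
  have rc: "?r \<in> carrier W" using c assms(3) by simp
  have xs: "ell x < ell (x \<otimes> s)" using assms(5) s unfolding right_min_def by blast
  have "ell (u \<otimes> x \<otimes> s) < ell (u \<otimes> x)"
    using neg ell_gen_right[of "u \<otimes> x" s] c assms(3) by auto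
  then have less: "ell (u \<otimes> ?r) < ell u"
    using descent_split[OF c(1) assms(3) c(2)] xs by auto
  obtain us where us: "set us \<subseteq> J" "word_prod W us = u"
    using parabolic_word[OF assms(1,6)] by blast
  let ?t = "u \<otimes> ?r \<otimes> inv u"
  have t: "?t \<in> reflections W S"
    using reflection_conj[OF reflection_conj[OF reflection_gen[OF c(2)] assms(3)] c(1)] .
  have "?t \<otimes> u = u \<otimes> ?r" using right_as_left[OF c(1) rc] .
  then obtain ys where "set ys \<subseteq> J" "u \<otimes> ?r = word_prod W ys"
    using exchange_parabolic[OF assms(1) us(1) t] us(2) less by auto
  then have "u \<otimes> ?r \<in> par J" using word_in_parabolic by simp
  then have "inv u \<otimes> (u \<otimes> ?r) \<in> par J"
    using parabolic_mult parabolic_inv[OF assms(1,6)] by blast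
  then have rJ: "?r \<in> par J" using inv_cancel_left(2)[OF c(1) rc] by simp
  have "?r \<otimes> x = x \<otimes> s" using right_as_left assms(3) c by auto
  then have "ell (x \<otimes> s) = ell ?r + ell x"
    using left_min_add[OF assms(1,3,4) rJ] by simp
  then have "ell ?r = 1" using ell_gen_right[OF assms(3) c(2)] xs by auto
  then have "?r \<in> redundancy J I x" using gen_in_parabolic[OF assms(1) rJ] s by blast
  then show False using assms(7) less unfolding right_min_def by force
qed

lemma triple_add:
  assumes "J \<subseteq> S" "I \<subseteq> S" "x \<in> carrier W" "left_min J x" "right_min I x"
    and "u \<in> par J" "right_min (redundancy J I x) u" "v \<in> par I"
  shows "ell (u \<otimes> x \<otimes> v) = ell u + ell x + ell v"
proof -
  have "u \<in> carrier W" using parabolic_closed[OF assms(1,6)] .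
  then show ?thesis
    using right_min_add[OF assms(2) _ right_min_translate[OF assms(1-7)] assms(8)]
      left_min_add[OF assms(1,3,4,6)] assms(3) by simp
qed

text \<open>Starting from \<open>b x v\<close>, the part of \<open>b\<close> that lies in \<open>W\<^sub>K\<close> can be moved across \<open>x\<close> into \<open>W\<^sub>I\<close>.\<close>

lemma dcoset_factor:
  assumes "J \<subseteq> S" "I \<subseteq> S" "x \<in> carrier W" "z \<in> dcoset J I x"
  shows "\<exists>u v. u \<in> par J \<and> v \<in> par I \<and> right_min (redundancy J I x) u \<and> z = u \<otimes> x \<otimes> v"
proof -
  let ?K = "redundancy J I x"
  have K: "?K \<subseteq> S" using assms(1) by auto
  obtain b v where b: "b \<in> par J" "v \<in> par I" "z = b \<otimes> x \<otimes> v"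
    using assms(4) unfolding in_dcoset by blast
  have bc: "b \<in> carrier W" "v \<in> carrier W" using b assms parabolic_closed by auto
  obtain u k where u: "u \<in> carrier W" "k \<in> par ?K" "b = u \<otimes> k" "right_min ?K u"
    using ex_right_min[OF K bc(1)] by blast
  have kJ: "k \<in> par J" using u(2) mono_generate[of ?K J] by blast
  have kc: "k \<in> carrier W" using parabolic_closed[OF assms(1) kJ] .
  have "u = b \<otimes> inv k" using u kc by (simp add: m_assoc)
  then have "u \<in> par J" using parabolic_mult[OF b(1) parabolic_inv[OF assms(1) kJ]] by simp
  moreover have "(inv x \<otimes> k \<otimes> x) \<otimes> v \<in> par I"
    using parabolic_mult[OF conj_redundancy[OF assms(1-3) u(2)] b(2)] .
  moreover have "z = u \<otimes> x \<otimes> ((inv x \<otimes> k \<otimes> x) \<otimes> v)"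
    using b(3) u kc bc assms(3) by (simp add: m_assoc inv_cancel_left)
  ultimately show ?thesis using u(4) by blast
qed

text \<open>By \<open>triple_add\<close>, applied from \<open>x\<close> and from \<open>z\<close>, each of the two is at least as long as the other, so
  the outer factors of \<open>z = u x v\<close> are trivial.\<close>

lemma min_unique:
  assumes "J \<subseteq> S" "I \<subseteq> S" "x \<in> carrier W" "left_min J x" "right_min I x"
    and "z \<in> dcoset J I x" "left_min J z" "right_min I z"
  shows "z = x"
proof -
  have z: "z \<in> carrier W" using dcoset_closed assms by blast
  have "x \<in> dcoset J I z"
    using dcoset_eq[OF assms(1-3,6)] dcoset_self[OF assms(3)] by simp
  then obtain u' v' where x: "u' \<in> par J" "v' \<in> par I" "right_min (redundancy J I z) u'"
    "x = u' \<otimes> z \<otimes> v'" using dcoset_factor[OF assms(1,2) z] by blast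
  obtain u v where uv: "u \<in> par J" "v \<in> par I" "right_min (redundancy J I x) u" "z = u \<otimes> x \<otimes> v"
    using dcoset_factor[OF assms(1-3,6)] by blast
  have c: "u \<in> carrier W" "v \<in> carrier W" using uv assms parabolic_closed by auto
  have "ell z = ell u + ell x + ell v"
    using triple_add[OF assms(1-5) uv(1,3,2)] uv(4) by simp
  moreover have "ell x = ell u' + ell z + ell v'"
    using triple_add[OF assms(1,2) z assms(7,8) x(1,3,2)] x(4) by simp
  ultimately have "u = \<one>" "v = \<one>" using ell_eq_0 c by auto
  then show ?thesis using uv(4) assms(3) by simp
qed

lemma min_shortest:
  assumes "J \<subseteq> S" "I \<subseteq> S" "x \<in> carrier W" "left_min J x" "right_min I x" "z \<in> dcoset J I x"
  shows "ell x \<le> ell z"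
proof -
  obtain u v where uv: "u \<in> par J" "v \<in> par I" "right_min (redundancy J I x) u" "z = u \<otimes> x \<otimes> v"
    using dcoset_factor[OF assms(1-3,6)] by blast
  then show ?thesis using triple_add[OF assms(1-5) uv(1,3,2)] by simp
qed

lemma ex_min:
  assumes "J \<subseteq> S" "I \<subseteq> S" "w \<in> carrier W"
  shows "\<exists>x. x \<in> carrier W \<and> left_min J x \<and> right_min I x \<and> dcoset J I x = dcoset J I w"
proof -
  obtain x where x: "x \<in> dcoset J I w" and least: "\<And>y. y \<in> dcoset J I w \<Longrightarrow> ell x \<le> ell y"
    using ex_has_least_nat[of "\<lambda>u. u \<in> dcoset J I w" w ell] dcoset_self[OF assms(3)] by blast
  have xc: "x \<in> carrier W" using dcoset_closed[OF assms x] .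
  have "left_min J x"
    unfolding left_min_def
    using least[OF dcoset_left[OF assms x parabolic_gen]] ell_gen_left[OF xc] assms(1) by fastforce
  moreover have "right_min I x"
    unfolding right_min_def
    using least[OF dcoset_right[OF assms x parabolic_gen]] ell_gen_right[OF xc] assms(2) by fastforce
  ultimately show ?thesis using xc dcoset_eq[OF assms x] by blast
qed

text \<open>The maximal element of the double coset of \<open>x\<close>, if \<open>x\<close> is its minimal element; see \<open>max_elt_dcoset\<close>.\<close>

definition top_of :: "'a set \<Rightarrow> 'a set \<Rightarrow> 'a \<Rightarrow> 'a" where
  "top_of J I x = longest_elt W S J \<otimes> inv (longest_elt W S (redundancy J I x)) \<otimes> x
    \<otimes> longest_elt W S I"

text \<open>The quotient \<open>w\<^sub>J w\<^sub>K\<^sup>-\<^sup>1\<close> is the longest of the elements of \<open>W\<^sub>J\<close> that are minimal modulo \<open>W\<^sub>K\<close>.\<close>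

lemma top_left_factor:
  assumes "finitary W S J" "K \<subseteq> J"
  defines "u \<equiv> longest_elt W S J \<otimes> inv (longest_elt W S K)"
  shows "u \<in> par J" "right_min K u" "ell (longest_elt W S J) = ell u + ell (longest_elt W S K)"
proof -
  have fK: "finitary W S K" using finitary_mono[OF assms(1,2)] .
  have J: "J \<subseteq> S" "K \<subseteq> S" using finitary_subset_gens assms(1) fK by auto
  let ?w = "longest_elt W S J" and ?k = "longest_elt W S K"
  have kJ: "?k \<in> par J" using longest_in[OF fK] mono_generate[OF assms(2)] by blast
  have c: "?w \<in> carrier W" "?k \<in> carrier W" using longest_closed assms(1) fK by auto
  show "u \<in> par J" unfolding u_def
    using parabolic_mult[OF longest_in[OF assms(1)] parabolic_inv[OF J(1) kJ]] .
  show e: "ell ?w = ell u + ell ?k" unfolding u_def using longest_split_right[OF assms(1) kJ] .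
  show "right_min K u" unfolding right_min_def
  proof
    fix s assume s: "s \<in> K"
    then have sS: "s \<in> S" and sJ: "s \<in> par J" using J assms(2) parabolic_gen by auto
    have "u \<otimes> s = ?w \<otimes> inv (s \<otimes> ?k)" unfolding u_def using c sS
      by (simp add: m_assoc inv_mult_group gen_inv)
    then have "ell ?w = ell (u \<otimes> s) + ell (s \<otimes> ?k)"
      using longest_split_right[OF assms(1) parabolic_mult[OF sJ kJ]] by simp
    moreover have "ell (s \<otimes> ?k) < ell ?k"
      using longest_left_max[OF fK] s unfolding left_max_def by blast
    ultimately show "ell u < ell (u \<otimes> s)" using e by simp
  qed
qed

context
  fixes J I :: "'a set" and x :: 'a
  assumes fin: "finitary W S J" "finitary W S I"
    and x: "x \<in> carrier W" "left_min J x" "right_min I x"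
begin

lemma sub: "J \<subseteq> S" "I \<subseteq> S"
  using fin finitary_subset_gens by auto

lemma redundancy_finitary: "finitary W S (redundancy J I x)"
  using finitary_mono[OF fin(1)] by simp

lemma top_in: "top_of J I x \<in> dcoset J I x"
  unfolding in_dcoset top_of_def
  using top_left_factor(1)[OF fin(1), of "redundancy J I x"] longest_in[OF fin(2)] by blast

lemma top_length:
  "ell (top_of J I x) + ell (longest_elt W S (redundancy J I x)) =
    ell (longest_elt W S J) + ell x + ell (longest_elt W S I)"
  unfolding top_of_def
  using top_left_factor[OF fin(1), of "redundancy J I x"]
    triple_add[OF sub x _ _ longest_in[OF fin(2)]] by simp

lemma top_longest:
  assumes "z \<in> dcoset J I x" shows "ell z \<le> ell (top_of J I x)"
proof -
  let ?K = "redundancy J I x"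
  have K: "?K \<subseteq> S" using sub by auto
  obtain u v where uv: "u \<in> par J" "v \<in> par I" "right_min ?K u" "z = u \<otimes> x \<otimes> v"
    using dcoset_factor[OF sub x(1) assms] by blast
  have kK: "longest_elt W S ?K \<in> par ?K" using longest_in[OF redundancy_finitary] .
  then have kJ: "longest_elt W S ?K \<in> par J" using mono_generate[of ?K J] by blast
  have "ell u + ell (longest_elt W S ?K) = ell (u \<otimes> longest_elt W S ?K)"
    using right_min_add[OF K parabolic_closed[OF sub(1) uv(1)] uv(3) kK] by simp
  also have "\<dots> \<le> ell (longest_elt W S J)"
    using longest_ge[OF fin(1) parabolic_mult[OF uv(1) kJ]] .
  finally show ?thesis
    using triple_add[OF sub x uv(1,3,2)] uv(4) longest_ge[OF fin(2) uv(2)] top_length by simp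
qed

lemma top_max: "left_max J (top_of J I x)" "right_max I (top_of J I x)"
proof -
  let ?y = "top_of J I x"
  have yc: "?y \<in> carrier W" using dcoset_closed[OF sub x(1) top_in] .
  show "left_max J ?y" unfolding left_max_def
    using top_longest[OF dcoset_left[OF sub x(1) top_in parabolic_gen]] ell_gen_left[OF yc] sub
    by fastforce
  show "right_max I ?y" unfolding right_max_def
    using top_longest[OF dcoset_right[OF sub x(1) top_in parabolic_gen]] ell_gen_right[OF yc] sub
    by fastforce
qed

text \<open>Write \<open>z = u x v\<close> with additive lengths. The descents in \<open>I\<close> force \<open>v = w\<^sub>I\<close>. The descents in \<open>J\<close> force
  \<open>u w\<^sub>K = w\<^sub>J\<close>: if \<open>s \<in> J\<close> prolonged \<open>u w\<^sub>K\<close>, then \<open>s u\<close> would still be minimal modulo \<open>W\<^sub>K\<close>, and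
  \<open>s z = (s u) x v\<close> would be longer than \<open>z\<close>.\<close>

lemma max_unique:
  assumes "z \<in> dcoset J I x" "left_max J z" "right_max I z"
  shows "z = top_of J I x"
proof -
  let ?K = "redundancy J I x"
  let ?k = "longest_elt W S ?K"
  have K: "?K \<subseteq> S" "?K \<subseteq> J" using sub by auto
  obtain u v where uv: "u \<in> par J" "v \<in> par I" "right_min ?K u" "z = u \<otimes> x \<otimes> v"
    using dcoset_factor[OF sub x(1) assms(1)] by blast
  have c: "u \<in> carrier W" "v \<in> carrier W" using uv sub parabolic_closed by auto
  have kK: "?k \<in> par ?K" using longest_in[OF redundancy_finitary] .
  have kJ: "?k \<in> par J" using kK mono_generate[OF K(2)] by blast
  have kc: "?k \<in> carrier W" using parabolic_closed[OF K(1) kK] .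
  have z: "ell z = ell u + ell x + ell v" using triple_add[OF sub x uv(1,3,2)] uv(4) by simp
  have "right_max I v"
    unfolding right_max_def
  proof
    fix s assume s: "s \<in> I"
    then have sS: "s \<in> S" using sub by auto
    have "z \<otimes> s = u \<otimes> x \<otimes> (v \<otimes> s)" using uv(4) c x(1) sS by (simp add: m_assoc)
    then have "ell (z \<otimes> s) = ell u + ell x + ell (v \<otimes> s)"
      using triple_add[OF sub x uv(1,3) parabolic_mult[OF uv(2) parabolic_gen[OF s]]] by simp
    moreover have "ell (z \<otimes> s) < ell z" using assms(3) s unfolding right_max_def by blast
    ultimately show "ell (v \<otimes> s) < ell v" using z by simp
  qed
  then have v: "v = longest_elt W S I" using longest_unique[OF fin(2) uv(2)] by blast
  have "left_max J (u \<otimes> ?k)"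
    unfolding left_max_def
  proof (rule ballI, rule ccontr)
    fix s assume s: "s \<in> J" and neg: "\<not> ell (s \<otimes> (u \<otimes> ?k)) < ell (u \<otimes> ?k)"
    then have sS: "s \<in> S" using sub by auto
    have suJ: "s \<otimes> u \<in> par J" using parabolic_mult[OF parabolic_gen[OF s] uv(1)] .
    have up: "ell (s \<otimes> (u \<otimes> ?k)) = ell u + ell ?k + 1"
      using neg ell_gen_left[of "u \<otimes> ?k" s] right_min_add[OF K(1) c(1) uv(3) kK] c kc sS by simp
    \<comment> \<open>A descent \<open>r\<close> of \<open>s u\<close> in \<open>K\<close> would give \<open>\<ell>(s u w\<^sub>K) \<le> \<ell>(s u r) + \<ell>(r w\<^sub>K) < \<ell>(u) + \<ell>(w\<^sub>K)\<close>.\<close>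
    have "right_min ?K (s \<otimes> u)"
      unfolding right_min_def
    proof (rule ballI, rule ccontr)
      fix r assume r: "r \<in> ?K" and "\<not> ell (s \<otimes> u) < ell (s \<otimes> u \<otimes> r)"
      then have rS: "r \<in> S" using K by blast
      have a: "ell (s \<otimes> u \<otimes> r) + 1 = ell (s \<otimes> u)"
        using \<open>\<not> ell (s \<otimes> u) < ell (s \<otimes> u \<otimes> r)\<close> ell_gen_right[of "s \<otimes> u" r] c sS rS by auto
      have b: "ell (r \<otimes> ?k) < ell ?k"
        using longest_left_max[OF redundancy_finitary] r unfolding left_max_def by blast
      have "s \<otimes> (u \<otimes> ?k) = (s \<otimes> u \<otimes> r) \<otimes> (r \<otimes> ?k)"
        using c sS rS kc by (simp add: m_assoc gen_cancel_left)
      then have "ell (s \<otimes> (u \<otimes> ?k)) \<le> ell (s \<otimes> u \<otimes> r) + ell (r \<otimes> ?k)"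
        using ell_mult[of "s \<otimes> u \<otimes> r" "r \<otimes> ?k"] c sS rS kc by simp
      moreover have "ell (s \<otimes> u) \<le> ell u + 1" using ell_mult[of s u] ell_gen[OF sS] c sS by simp
      ultimately show False using a b up by simp
    qed
    moreover have "s \<otimes> z = (s \<otimes> u) \<otimes> x \<otimes> v" using uv(4) c x(1) sS by (simp add: m_assoc)
    ultimately have "ell (s \<otimes> z) = ell (s \<otimes> u) + ell x + ell v"
      using triple_add[OF sub x suJ _ uv(2)] by simp
    moreover have "ell (s \<otimes> (u \<otimes> ?k)) \<le> ell (s \<otimes> u) + ell ?k"
      using ell_mult[of "s \<otimes> u" ?k] c sS kc by (simp add: m_assoc)
    moreover have "ell (s \<otimes> z) < ell z" using assms(2) s unfolding left_max_def by blast
    ultimately show False using z up by simp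
  qed
  then have "u \<otimes> ?k = longest_elt W S J"
    using longest_left_unique[OF fin(1) parabolic_mult[OF uv(1) kJ]] by blast
  then have "longest_elt W S J \<otimes> inv ?k = u \<otimes> ?k \<otimes> inv ?k" by simp
  also have "\<dots> = u" using c kc by (simp add: m_assoc)
  finally have "longest_elt W S J \<otimes> inv ?k = u" .
  then show ?thesis unfolding top_of_def using uv(4) v by simp
qed

end

section \<open>Bruhat-extremal elements\<close>

lemma bruhat_le_less:
  assumes "bruhat_le W S y z" shows "y = z \<or> ell y < ell z"
  using assms unfolding bruhat_le_def
  by (induction rule: rtrancl_induct) (auto simp: bruhat_step_def)

lemma bruhat_le_left:
  assumes "z \<in> carrier W" "s \<in> S" "ell z < ell (s \<otimes> z)"
  shows "bruhat_le W S z (s \<otimes> z)"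
proof -
  have "inv z \<otimes> s \<otimes> z \<in> reflections W S"
    using reflection_conj[OF reflection_gen[OF assms(2)], of "inv z"] assms(1) by simp
  moreover have "s \<otimes> z = z \<otimes> (inv z \<otimes> s \<otimes> z)"
    using assms by (simp add: m_assoc inv_cancel_left)
  ultimately show ?thesis using assms unfolding bruhat_le_def bruhat_step_def by auto
qed

lemma bruhat_le_right:
  assumes "z \<in> carrier W" "s \<in> S" "ell z < ell (z \<otimes> s)"
  shows "bruhat_le W S z (z \<otimes> s)"
  using assms reflection_gen unfolding bruhat_le_def bruhat_step_def by auto

text \<open>Multiplication by a simple reflection on either side stays in the double coset and is a step of the
  Bruhat order, so an element that is minimal in the Bruhat order has no descents in \<open>J\<close> and \<open>I\<close>.
  Together with \<open>min_unique\<close> this identifies the minimal element.\<close>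

lemma bruhat_minimal_descents:
  assumes "J \<subseteq> S" "I \<subseteq> S" "w \<in> carrier W" "z \<in> dcoset J I w"
    and minimal: "\<forall>y\<in>dcoset J I w. bruhat_le W S y z \<longrightarrow> y = z"
  shows "left_min J z" "right_min I z"
proof -
  have z: "z \<in> carrier W" using dcoset_closed assms by blast
  show "left_min J z" unfolding left_min_def
  proof (rule ballI, rule ccontr)
    fix s assume s: "s \<in> J" and neg: "\<not> ell z < ell (s \<otimes> z)"
    have sS: "s \<in> S" using s assms by auto
    have less: "ell (s \<otimes> z) < ell z" using neg ell_gen_left[OF z sS] by auto
    have "bruhat_le W S (s \<otimes> z) z"
      using bruhat_le_left[of "s \<otimes> z" s] less z sS by (simp add: gen_cancel_left)
    then have "s \<otimes> z = z" using minimal dcoset_left[OF assms(1-4) parabolic_gen[OF s]] by blast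
    then show False using less by simp
  qed
  show "right_min I z" unfolding right_min_def
  proof (rule ballI, rule ccontr)
    fix s assume s: "s \<in> I" and neg: "\<not> ell z < ell (z \<otimes> s)"
    have sS: "s \<in> S" using s assms by auto
    have less: "ell (z \<otimes> s) < ell z" using neg ell_gen_right[OF z sS] by auto
    have "bruhat_le W S (z \<otimes> s) z"
      using bruhat_le_right[of "z \<otimes> s" s] less z sS by (simp add: gen_cancel_right)
    then have "z \<otimes> s = z" using minimal dcoset_right[OF assms(1-4) parabolic_gen[OF s]] by blast
    then show False using less by simp
  qed
qed

lemma bruhat_maximal_descents:
  assumes "J \<subseteq> S" "I \<subseteq> S" "w \<in> carrier W" "z \<in> dcoset J I w"
    and maximal: "\<forall>y\<in>dcoset J I w. bruhat_le W S z y \<longrightarrow> y = z"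
  shows "left_max J z" "right_max I z"
proof -
  have z: "z \<in> carrier W" using dcoset_closed assms by blast
  show "left_max J z" unfolding left_max_def
  proof (rule ballI, rule ccontr)
    fix s assume s: "s \<in> J" and neg: "\<not> ell (s \<otimes> z) < ell z"
    have sS: "s \<in> S" using s assms by auto
    have less: "ell z < ell (s \<otimes> z)" using neg ell_gen_left[OF z sS] by auto
    then have "s \<otimes> z = z"
      using maximal dcoset_left[OF assms(1-4) parabolic_gen[OF s]] bruhat_le_left[OF z sS] by blast
    then show False using less by simp
  qed
  show "right_max I z" unfolding right_max_def
  proof (rule ballI, rule ccontr)
    fix s assume s: "s \<in> I" and neg: "\<not> ell (z \<otimes> s) < ell z"
    have sS: "s \<in> S" using s assms by auto
    have less: "ell z < ell (z \<otimes> s)" using neg ell_gen_right[OF z sS] by auto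
    then have "z \<otimes> s = z"
      using maximal dcoset_right[OF assms(1-4) parabolic_gen[OF s]] bruhat_le_right[OF z sS] by blast
    then show False using less by simp
  qed
qed

lemma min_elt_dcoset:
  assumes "J \<subseteq> S" "I \<subseteq> S" "x \<in> carrier W" "left_min J x" "right_min I x"
  shows "min_elt W S (dcoset J I x) = x"
  unfolding min_elt_def
proof (rule the_equality)
  show "x \<in> dcoset J I x \<and> (\<forall>y\<in>dcoset J I x. bruhat_le W S y x \<longrightarrow> y = x)"
    using dcoset_self[OF assms(3)] min_shortest[OF assms] bruhat_le_less by fastforce
  fix z assume "z \<in> dcoset J I x \<and> (\<forall>y\<in>dcoset J I x. bruhat_le W S y z \<longrightarrow> y = z)"
  then show "z = x"
    using min_unique[OF assms] bruhat_minimal_descents[OF assms(1-3)] by blast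
qed

lemma max_elt_dcoset:
  assumes "finitary W S J" "finitary W S I" "x \<in> carrier W" "left_min J x" "right_min I x"
  shows "max_elt W S (dcoset J I x) = top_of J I x"
  unfolding max_elt_def
proof (rule the_equality)
  have s: "J \<subseteq> S" "I \<subseteq> S" using finitary_subset_gens assms by auto
  show "top_of J I x \<in> dcoset J I x \<and>
      (\<forall>y\<in>dcoset J I x. bruhat_le W S (top_of J I x) y \<longrightarrow> y = top_of J I x)"
    using top_in[OF assms] top_longest[OF assms] bruhat_le_less by fastforce
  fix z assume "z \<in> dcoset J I x \<and> (\<forall>y\<in>dcoset J I x. bruhat_le W S z y \<longrightarrow> y = z)"
  then show "z = top_of J I x"
    using max_unique[OF assms] bruhat_maximal_descents[OF s assms(3)] by blast
qed

section \<open>Lengths of double cosets along an expression\<close>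

lemma double_cosets_iff:
  "p \<in> double_cosets W J I \<longleftrightarrow> (\<exists>w\<in>carrier W. p = dcoset J I w)"
  unfolding double_cosets_def by blast

lemma coset_containing_eq:
  assumes "J \<subseteq> S" "I \<subseteq> S" "w \<in> carrier W" "X \<subseteq> dcoset J I w" "X \<noteq> {}"
  shows "coset_containing W J I X = dcoset J I w"
  unfolding coset_containing_def
proof (rule the_equality)
  show "dcoset J I w \<in> double_cosets W J I \<and> X \<subseteq> dcoset J I w"
    using assms unfolding double_cosets_iff by blast
  fix q assume q: "q \<in> double_cosets W J I \<and> X \<subseteq> q"
  then obtain v where v: "v \<in> carrier W" "q = dcoset J I v" unfolding double_cosets_iff by blast
  obtain z where z: "z \<in> X" using assms(5) by blast
  have "dcoset J I z = dcoset J I v" using dcoset_eq[OF assms(1,2) v(1)] q v(2) z by blast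
  moreover have "dcoset J I z = dcoset J I w" using dcoset_eq[OF assms(1-3)] assms(4) z by blast
  ultimately show "q = dcoset J I w" using v by simp
qed

lemma coset_repr:
  assumes "finitary W S J" "finitary W S I" "p \<in> double_cosets W J I"
  shows "\<exists>x. x \<in> carrier W \<and> left_min J x \<and> right_min I x \<and> p = dcoset J I x \<and>
    min_elt W S p = x \<and> max_elt W S p = top_of J I x \<and>
    left_redundancy W S J I p = redundancy J I x"
proof -
  have s: "J \<subseteq> S" "I \<subseteq> S" using finitary_subset_gens assms by auto
  obtain w where w: "w \<in> carrier W" "p = dcoset J I w" using assms(3) double_cosets_iff by blast
  obtain x where x: "x \<in> carrier W" "left_min J x" "right_min I x" "dcoset J I x = dcoset J I w"
    using ex_min[OF s w(1)] by blast
  then show ?thesis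
    using min_elt_dcoset[OF s x(1-3)] max_elt_dcoset[OF assms(1,2) x(1-3)] w(2)
    unfolding left_redundancy_def by (intro exI[of _ x]) simp
qed

text \<open>Both lengths equal \<open>\<ell>(x) - \<ell>(K)\<close> up to the constants \<open>\<ell>(I)\<close> and \<open>\<ell>(J)\<close>.\<close>

lemma coset_len_plus_minus:
  assumes "finitary W S J" "finitary W S I" "p \<in> double_cosets W J I"
  shows "coset_len_plus W S J I p = coset_len_minus W S J I p + plen W S I - plen W S J"
proof -
  obtain x where x: "x \<in> carrier W" "left_min J x" "right_min I x"
    "min_elt W S p = x" "max_elt W S p = top_of J I x" "left_redundancy W S J I p = redundancy J I x"
    using coset_repr[OF assms] by blast
  show ?thesis
    using top_length[OF assms(1,2) x(1-3)] x(4-6)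
    unfolding coset_len_plus_def coset_len_minus_def plen_def len_def by simp
qed

lemma right_min_suffix:
  assumes "I \<subseteq> S" "u \<in> carrier W" "x \<in> carrier W"
    and "ell (u \<otimes> x) = ell u + ell x" and "right_min I (u \<otimes> x)"
  shows "right_min I x"
  unfolding right_min_def
proof
  fix s assume s: "s \<in> I"
  then have sS: "s \<in> S" using assms(1) by auto
  have "ell (u \<otimes> x) < ell (u \<otimes> x \<otimes> s)" using assms(5) s unfolding right_min_def by blast
  also have "\<dots> \<le> ell u + ell (x \<otimes> s)"
    using ell_mult[of u "x \<otimes> s"] assms(2,3) sS by (simp add: m_assoc)
  finally show "ell x < ell (x \<otimes> s)" using assms(4) by simp
qed

lemma left_max_prefix:
  assumes "J \<subseteq> S" "y \<in> carrier W" "c \<in> carrier W" "left_max J y" "ell (y \<otimes> c) = ell y + ell c"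
  shows "left_max J (y \<otimes> c)"
  unfolding left_max_def
proof
  fix s assume s: "s \<in> J"
  then have sS: "s \<in> S" using assms(1) by auto
  have "ell (s \<otimes> (y \<otimes> c)) \<le> ell (s \<otimes> y) + ell c"
    using ell_mult[of "s \<otimes> y" c] assms(2,3) sS by (simp add: m_assoc)
  also have "\<dots> < ell y + ell c" using assms(4) s unfolding left_max_def by simp
  finally show "ell (s \<otimes> (y \<otimes> c)) < ell (y \<otimes> c)" using assms(5) by simp
qed

text \<open>Left descents persist when a word is prolonged on the right. So the longest element of the right coset
  \<open>y W\<^sub>I\<^sub>'\<close> of the maximal element \<open>y\<close> of \<open>p\<close> still has all descents in \<open>J\<close>, and it is the maximal element
  of the enlarged coset.\<close>

lemma enlarge_step:
  assumes fin: "finitary W S J" "finitary W S I" "finitary W S I'" and "I \<subseteq> I'"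
    and p: "p \<in> double_cosets W J I"
  defines "q \<equiv> coset_containing W J I' p"
  shows "q \<in> double_cosets W J I'"
    and "coset_len_minus W S J I' q \<le> coset_len_minus W S J I p"
    and "coset_len_minus W S J I' q = coset_len_minus W S J I p \<longleftrightarrow>
      min_elt W S p = min_elt W S q \<and> left_redundancy W S J I p = left_redundancy W S J I' q"
proof -
  have s: "J \<subseteq> S" "I \<subseteq> S" "I' \<subseteq> S" using finitary_subset_gens fin by auto
  obtain x where x: "x \<in> carrier W" "left_min J x" "right_min I x" "p = dcoset J I x"
    "min_elt W S p = x" "max_elt W S p = top_of J I x" "left_redundancy W S J I p = redundancy J I x"
    using coset_repr[OF fin(1,2) p] by blast
  have "p \<subseteq> dcoset J I' x"
    using mono_generate[OF assms(4)] unfolding x(4) set_mult_def by blast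
  then have q: "q = dcoset J I' x"
    unfolding q_def using coset_containing_eq[OF s(1,3) x(1)] dcoset_self[OF x(1)] x(4) by blast
  then show qd: "q \<in> double_cosets W J I'" unfolding double_cosets_iff using x(1) by blast
  obtain x' where x': "x' \<in> carrier W" "left_min J x'" "right_min I' x'" "q = dcoset J I' x'"
    "min_elt W S q = x'" "max_elt W S q = top_of J I' x'" "left_redundancy W S J I' q = redundancy J I' x'"
    using coset_repr[OF fin(1,3) qd] by blast
  let ?K = "redundancy J I x" and ?K' = "redundancy J I' x'"
  let ?wI = "longest_elt W S I" and ?wI' = "longest_elt W S I'"
  let ?y = "top_of J I x"
  define u where "u = longest_elt W S J \<otimes> inv (longest_elt W S ?K)"
  \<comment> \<open>The elements \<open>a\<close> and \<open>b\<close> are the shortest ones in \<open>y W\<^sub>I\<close> and \<open>y W\<^sub>I\<^sub>'\<close>; the values of \<open>\<ell>\<^sup>-\<close> before and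
    after the step are their lengths.\<close>
  define a where "a = u \<otimes> x"
  have u: "u \<in> par J" "right_min ?K u"
    unfolding u_def using top_left_factor[OF fin(1)] by auto
  have uc: "u \<in> carrier W" using parabolic_closed[OF s(1) u(1)] .
  have ac: "a \<in> carrier W" unfolding a_def using uc x(1) by simp
  have wc: "?wI \<in> carrier W" "?wI' \<in> carrier W" using longest_closed fin by auto
  have ya: "?y = a \<otimes> ?wI" unfolding top_of_def a_def u_def by simp
  have la: "ell a = ell u + ell x" unfolding a_def using left_min_add[OF s(1) x(1,2) u(1)] .
  have ra: "right_min I a"
    unfolding a_def using right_min_translate[OF s(1,2) x(1-3) u] .
  have ly: "ell ?y = ell a + ell ?wI"
    unfolding ya using right_min_add[OF s(2) ac ra longest_in[OF fin(2)]] .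
  obtain b v where b: "b \<in> carrier W" "v \<in> par I'" "a = b \<otimes> v" "right_min I' b"
    using ex_right_min[OF s(3) ac] by blast
  have vc: "v \<in> carrier W" using parabolic_closed[OF s(3) b(2)] .
  have lab: "ell a = ell b + ell v" unfolding b(3) using right_min_add[OF s(3) b(1,4,2)] .
  let ?z = "b \<otimes> ?wI'"
  have lz: "ell ?z = ell b + ell ?wI'" using right_min_add[OF s(3) b(1,4) longest_in[OF fin(3)]] .
  let ?v = "v \<otimes> ?wI"
  have v': "?v \<in> par I'"
    using parabolic_mult[OF b(2)] longest_in[OF fin(2)] mono_generate[OF assms(4)] by blast
  have vc': "?v \<in> carrier W" using vc wc by simp
  let ?c = "inv ?v \<otimes> ?wI'"
  have cc: "?c \<in> carrier W" using vc' wc by simp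
  have yb: "?y = b \<otimes> ?v" using ya b(3) b(1) vc wc by (simp add: m_assoc)
  have yc: "?y \<in> carrier W" unfolding yb using b(1) vc' by simp
  \<comment> \<open>The longest element \<open>z\<close> of \<open>y W\<^sub>I\<^sub>'\<close> prolongs \<open>y\<close>, so it inherits the left descents of \<open>y\<close>.\<close>
  have zy: "?z = ?y \<otimes> ?c"
    unfolding yb using b(1) vc' wc by (simp add: m_assoc[of b] inv_cancel_left)
  have "ell ?y = ell b + ell ?v" unfolding yb using right_min_add[OF s(3) b(1,4) v'] .
  then have "ell (?y \<otimes> ?c) = ell ?y + ell ?c"
    using lz longest_split_left[OF fin(3) v'] unfolding zy by simp
  then have lmz: "left_max J ?z"
    unfolding zy using left_max_prefix[OF s(1) yc cc top_max(1)[OF fin(1,2) x(1-3)]] by simp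
  have rmz: "right_max I' ?z"
    unfolding right_max_def
  proof
    fix r assume r: "r \<in> I'"
    then have rc: "r \<in> carrier W" using s(3) by auto
    have "ell (b \<otimes> (?wI' \<otimes> r)) = ell b + ell (?wI' \<otimes> r)"
      using right_min_add[OF s(3) b(1,4) parabolic_mult[OF longest_in[OF fin(3)] parabolic_gen[OF r]]] .
    moreover have "ell (?wI' \<otimes> r) < ell ?wI'"
      using longest_max[OF fin(3)] r unfolding right_max_def by blast
    ultimately show "ell (?z \<otimes> r) < ell ?z" using lz b(1) wc rc by (simp add: m_assoc)
  qed
  have "?z = u \<otimes> x \<otimes> (inv v \<otimes> ?wI')"
  proof -
    have "b = a \<otimes> inv v" using b(1,3) vc by (simp add: m_assoc)
    then show ?thesis using a_def ac uc x(1) vc wc by (simp add: m_assoc)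
  qed
  moreover have "inv v \<otimes> ?wI' \<in> par I'"
    using parabolic_mult[OF parabolic_inv[OF s(3) b(2)] longest_in[OF fin(3)]] .
  ultimately have zq: "?z \<in> dcoset J I' x'"
    using q x'(4) u(1) in_dcoset by metis
  have "?z = top_of J I' x'" using max_unique[OF fin(1,3) x'(1-3) zq lmz rmz] .
  then have lt: "ell (top_of J I' x') = ell b + ell ?wI'" using lz by simp
  have P: "coset_len_plus W S J I p = int (ell a + ell ?wI) - plen W S J"
    unfolding coset_len_plus_def len_def x(6) using ly by simp
  have Q: "coset_len_plus W S J I' q = int (ell b + ell ?wI') - plen W S J"
    unfolding coset_len_plus_def len_def x'(6) using lt by simp
  have MP: "coset_len_minus W S J I p = int (ell a)"
    using coset_len_plus_minus[OF fin(1,2) p] P unfolding plen_def len_def by simp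
  have MQ: "coset_len_minus W S J I' q = int (ell b)"
    using coset_len_plus_minus[OF fin(1,3) qd] Q unfolding plen_def len_def by simp
  show "coset_len_minus W S J I' q \<le> coset_len_minus W S J I p"
    unfolding MP MQ using lab by simp
  show "coset_len_minus W S J I' q = coset_len_minus W S J I p \<longleftrightarrow>
      min_elt W S p = min_elt W S q \<and> left_redundancy W S J I p = left_redundancy W S J I' q"
    (is "?l \<longleftrightarrow> ?r")
  proof
    assume ?r
    then show ?l unfolding coset_len_minus_def by simp
  next
    assume l: ?l
    then have "ell v = 0" using lab unfolding MP MQ by simp
    then have "a = b" using b ell_eq_0[OF vc] by simp
    then have "right_min I' x"
      using right_min_suffix[OF s(3) uc x(1)] la b(4) unfolding a_def by simp
    moreover have "x \<in> dcoset J I' x'" using q x'(4) dcoset_self[OF x(1)] by simp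
    ultimately have xx: "x = x'" using min_unique[OF s(1,3) x'(1-3) _ x(2)] by blast
    have "?K \<subseteq> ?K'" unfolding xx using assms(4) by blast
    moreover have "ell (longest_elt W S ?K) = ell (longest_elt W S ?K')"
      using l unfolding coset_len_minus_def plen_def len_def x(5,7) x'(5,7) xx by simp
    ultimately have "?K = ?K'"
      by (rule longest_length_inj[OF redundancy_finitary[OF fin(1,3) x'(1-3)]])
    then show ?r using x(5,7) x'(5,7) xx by simp
  qed
qed

text \<open>The maximal element of \<open>p\<close> keeps all its descents in \<open>J\<close> and in the smaller set \<open>I'\<close>, so it is also the
  maximal element of the new coset.\<close>

lemma shrink_step:
  assumes fin: "finitary W S J" "finitary W S I" "finitary W S I'" and "I' \<subseteq> I"
    and p: "p \<in> double_cosets W J I"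
  defines "q \<equiv> coset_containing W J I' {max_elt W S p}"
  shows "q \<in> double_cosets W J I'"
    and "coset_len_minus W S J I' q = coset_len_minus W S J I p + plen W S I - plen W S I'"
proof -
  have s: "J \<subseteq> S" "I \<subseteq> S" "I' \<subseteq> S" using finitary_subset_gens fin by auto
  obtain x where x: "x \<in> carrier W" "left_min J x" "right_min I x" "max_elt W S p = top_of J I x"
    using coset_repr[OF fin(1,2) p] by blast
  let ?y = "top_of J I x"
  have y: "?y \<in> carrier W" using dcoset_closed[OF s(1,2) x(1) top_in[OF fin(1,2) x(1-3)]] .
  have q: "q = dcoset J I' ?y"
    unfolding q_def x(4) using coset_containing_eq[OF s(1,3) y] dcoset_self[OF y] by simp
  then show qd: "q \<in> double_cosets W J I'" unfolding double_cosets_iff using y by blast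
  obtain x' where x': "x' \<in> carrier W" "left_min J x'" "right_min I' x'" "q = dcoset J I' x'"
    "max_elt W S q = top_of J I' x'"
    using coset_repr[OF fin(1,3) qd] by blast
  have "?y \<in> dcoset J I' x'" using q x'(4) dcoset_self[OF y] by simp
  moreover have "left_max J ?y" "right_max I' ?y"
    using top_max[OF fin(1,2) x(1-3)] assms(4) unfolding right_max_def by auto
  ultimately have "?y = top_of J I' x'" using max_unique[OF fin(1,3) x'(1-3)] by blast
  then have "coset_len_plus W S J I' q = coset_len_plus W S J I p"
    unfolding coset_len_plus_def x(4) x'(5) by simp
  then show "coset_len_minus W S J I' q = coset_len_minus W S J I p + plen W S I - plen W S I'"
    using coset_len_plus_minus[OF fin(1,2) p] coset_len_plus_minus[OF fin(1,3) qd] by simp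
qed

lemma start_coset:
  assumes "finitary W S J"
  defines "p \<equiv> coset_containing W J J {\<one>}"
  shows "p \<in> double_cosets W J J" "coset_len_minus W S J J p = 0"
proof -
  have J: "J \<subseteq> S" using finitary_subset_gens assms(1) .
  have p: "p = dcoset J J \<one>"
    unfolding p_def using coset_containing_eq[OF J J one_closed] dcoset_self[OF one_closed] by simp
  then show "p \<in> double_cosets W J J" unfolding double_cosets_iff using one_closed by blast
  have "left_min J \<one>" "right_min J \<one>"
    using J ell_gen unfolding left_min_def right_min_def by auto
  then have m: "min_elt W S p = \<one>" unfolding p using min_elt_dcoset[OF J J one_closed] by simp
  have "{\<one> \<otimes> s \<otimes> inv \<one> | s. s \<in> J} = J" using J by force
  then have "left_redundancy W S J J p = J" unfolding left_redundancy_def m by simp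
  then show "coset_len_minus W S J J p = 0" unfolding coset_len_minus_def m len_def by simp
qed

lemma expression_step:
  assumes "singular_expression W S Is" "Suc i < length Is"
  shows "Is ! i \<subset> Is ! Suc i \<or> Is ! Suc i \<subset> Is ! i"
proof -
  obtain s where "(s \<notin> Is ! i \<and> Is ! Suc i = insert s (Is ! i)) \<or>
               (s \<in> Is ! i \<and> Is ! Suc i = Is ! i - {s})"
    using assms unfolding singular_expression_def by blast
  then show ?thesis by auto
qed

lemma expression_finitary:
  "singular_expression W S Is \<Longrightarrow> i < length Is \<Longrightarrow> finitary W S (Is ! i)"
  unfolding singular_expression_def by simp

definition reduced_step :: "'a set list \<Rightarrow> nat \<Rightarrow> bool" where
  "reduced_step Is i \<longleftrightarrow> (Is ! i \<subset> Is ! Suc i \<longrightarrow>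
      min_elt W S (forward_path W S Is i) = min_elt W S (forward_path W S Is (Suc i)) \<and>
      left_redundancy W S (Is ! 0) (Is ! i) (forward_path W S Is i) =
      left_redundancy W S (Is ! 0) (Is ! Suc i) (forward_path W S Is (Suc i)))"

text \<open>The difference between the negative length of the initial segment and that of the coset reached starts
  at \<open>0\<close>, is constant along shrinking steps, and along an enlarging step grows by the amount by which the
  negative length of the coset drops.\<close>

lemma path_minus:
  assumes "singular_expression W S Is" "k < length Is"
  defines "m \<equiv> \<lambda>i. coset_len_minus W S (Is ! 0) (Is ! i) (forward_path W S Is i)"
  shows "forward_path W S Is k \<in> double_cosets W (Is ! 0) (Is ! k) \<and>
    m k \<le> (\<Sum>i = 0..k. d_minus W S Is i) \<and>
    ((\<Sum>i = 0..k. d_minus W S Is i) = m k \<longleftrightarrow> (\<forall>i<k. reduced_step Is i))"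
  using assms(2)
proof (induction k)
  case 0
  then show ?case using start_coset expression_finitary[OF assms(1), of 0]
    by (simp add: m_def d_minus_def)
next
  case (Suc k)
  let ?p = "forward_path W S Is k" and ?J = "Is ! 0" and ?I = "Is ! k" and ?I' = "Is ! Suc k"
  let ?sum = "\<Sum>i = 0..k. d_minus W S Is i"
  have fin: "finitary W S ?J" "finitary W S ?I" "finitary W S ?I'"
    by (rule expression_finitary[OF assms(1)], use Suc.prems in linarith)+
  have IH: "?p \<in> double_cosets W ?J ?I" "m k \<le> ?sum" "?sum = m k \<longleftrightarrow> (\<forall>i<k. reduced_step Is i)"
    using Suc by auto
  have all: "(\<forall>i<Suc k. reduced_step Is i) \<longleftrightarrow> (\<forall>i<k. reduced_step Is i) \<and> reduced_step Is k"
    by (auto simp: less_Suc_eq)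
  from expression_step[OF assms(1) Suc.prems] show ?case
  proof
    assume up: "?I \<subset> ?I'"
    then have q: "forward_path W S Is (Suc k) = coset_containing W ?J ?I' ?p" by simp
    have d: "d_minus W S Is (Suc k) = 0" using up by (auto simp: d_minus_def)
    have sub: "?I \<subseteq> ?I'" using up by blast
    note step = enlarge_step[OF fin sub IH(1), folded q]
    have "reduced_step Is k \<longleftrightarrow> m (Suc k) = m k"
      unfolding reduced_step_def m_def using step(3) up by simp
    moreover have "m (Suc k) \<le> m k" unfolding m_def using step(2) .
    ultimately show ?thesis using step(1) IH(2,3) d all by auto
  next
    assume down: "?I' \<subset> ?I"
    then have nup: "\<not> ?I \<subset> ?I'" by blast
    then have q: "forward_path W S Is (Suc k) = coset_containing W ?J ?I' {max_elt W S ?p}" by simp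
    have d: "d_minus W S Is (Suc k) = plen W S ?I - plen W S ?I'"
      using down by (simp add: d_minus_def)
    have sub: "?I' \<subseteq> ?I" using down by blast
    note step = shrink_step[OF fin sub IH(1), folded q]
    have "reduced_step Is k" unfolding reduced_step_def using nup by blast
    moreover have "m (Suc k) = m k + plen W S ?I - plen W S ?I'" unfolding m_def using step(2) .
    ultimately show ?thesis using step(1) IH(2,3) d all by auto
  qed
qed

lemma path_plus_minus:
  assumes "singular_expression W S Is" "k < length Is"
  shows "(\<Sum>i = 0..k. d_plus W S Is i) =
    (\<Sum>i = 0..k. d_minus W S Is i) + plen W S (Is ! k) - plen W S (Is ! 0)"
  using assms(2)
proof (induction k)
  case (Suc k)
  have "d_plus W S Is (Suc k) = d_minus W S Is (Suc k) + plen W S (Is ! Suc k) - plen W S (Is ! k)"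
    using expression_step[OF assms(1) Suc.prems] by (auto simp: d_plus_def d_minus_def)
  then show ?case using Suc by simp
qed (simp add: d_plus_def d_minus_def)

end

theorem proposition3p17:
  fixes W :: "('a, 'b) monoid_scheme" and S :: "'a set" and Is :: "'a set list"
    and J I p :: "'a set"
  assumes "coxeter_system W S"
    and "singular_expression W S Is"
    and "J = Is ! 0" and "I = Is ! (length Is - 1)"
    and "p = endpoint W S Is"
  shows "expr_len_plus W S Is \<ge> coset_len_plus W S J I p
    \<and> expr_len_minus W S Is \<ge> coset_len_minus W S J I p
    \<and> (reduced_expression W S Is \<longleftrightarrow>
         expr_len_plus W S Is = coset_len_plus W S J I p \<and>
         expr_len_minus W S Is = coset_len_minus W S J I p)
    \<and> (reduced_expression W S Is \<longleftrightarrow> expr_len W S Is = coset_len W S J I p)"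
proof -
  interpret coxeter_system W S by fact
  let ?n = "length Is - 1"
  have n: "?n < length Is" "0 < length Is" using assms(2) unfolding singular_expression_def by auto
  have fin: "finitary W S J" "finitary W S I"
    unfolding assms(3,4) using expression_finitary[OF assms(2)] n by auto
  have p: "p \<in> double_cosets W J I"
    and le: "coset_len_minus W S J I p \<le> expr_len_minus W S Is"
    and eq: "expr_len_minus W S Is = coset_len_minus W S J I p \<longleftrightarrow> (\<forall>i<?n. reduced_step Is i)"
    using path_minus[OF assms(2) n(1)]
    unfolding assms(3-5) endpoint_def expr_len_minus_def by blast+
  have "Suc i < length Is \<longleftrightarrow> i < ?n" for i by auto
  then have "reduced_expression W S Is \<longleftrightarrow> (\<forall>i<?n. reduced_step Is i)"
    unfolding reduced_expression_def reduced_step_def by simp blast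
  moreover have "expr_len_plus W S Is = expr_len_minus W S Is + plen W S I - plen W S J"
    unfolding expr_len_plus_def expr_len_minus_def assms(3,4)
    using path_plus_minus[OF assms(2) n(1)] .
  moreover note coset_len_plus_minus[OF fin p]
  ultimately show ?thesis
    using le eq unfolding expr_len_def coset_len_def by auto
qed

end
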